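(* Let $\Phi=(G,\varphi)$ be a $\mathbb{T}$-gain graph and let $\mu(G)$ be the matching number of $G$. Then $\mathcal{E}(\Phi)=2\mu(G)$ if and only if each connected component of $\Phi$ is either an isolated vertex or a balanced $\mathbb{T}$-gain graph whose underlying graph is a complete bipartite graph with a perfect matching (i.e. $K_{p,p}$ for some $p\geq1$).
   Context: A $\mathbb{T}$-gain graph $\Phi=(G,\varphi)$ consists of a finite simple graph $G$ and a map $\varphi$ assigning to each orientation $\overrightarrow{e_{p,q}}$ of each edge $v_pv_q$ a value in $\mathbb{T}=\{z\in\mathbb{C}:|z|=1\}$, with $\varphi(\overrightarrow{e_{q,p}})=\varphi(\overrightarrow{e_{p,q}})^{-1}$. Its adjacency matrix $A(\Phi)$ is the Hermitian matrix whose $(p,q)$ entry is $\varphi(\overrightarrow{e_{p,q}})$ if $v_p\sim v_q$ and $0$ otherwise; the energy $\mathcal{E}(\Phi)$ is the sum of absolute values of the eigenvalues of $A(\Phi)$. The gain of an oriented cycle is the product of the gains along it; $\Phi$ is balanced if every oriented cycle has gain $1$. The matching number $\mu(G)$ is the maximum number of pairwise disjoint edges of $G$. *)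

theory Defs
  imports
    "Graph_Theory.Kuratowski"
    "Jordan_Normal_Form.Spectral_Radius"
begin

text \<open>
  A finite simple graph is a finite symmetric loop-free digraph (locale \<^locale>\<open>pair_graph\<close>);
  its arcs are the pairs \<open>(u, v)\<close>, i.e. the two orientations of each edge \<open>{u, v}\<close>.
  The values of \<open>\<phi>\<close> on pairs that are not arcs are irrelevant.
\<close>

locale gain_graph = pair_graph G for G :: "'a pair_pre_digraph" +
  fixes \<phi> :: "'a \<times> 'a \<Rightarrow> complex"
  assumes gain_unit: "(u, v) \<in> parcs G \<Longrightarrow> cmod (\<phi> (u, v)) = 1"
    and gain_rev: "(u, v) \<in> parcs G \<Longrightarrow> \<phi> (v, u) = inverse (\<phi> (u, v))"

text \<open>
  The list \<open>vs\<close> is the enumeration \<open>v\<^sub>1, \<dots>, v\<^sub>n\<close> of the vertices that orders rows and columns.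
\<close>

definition gain_adjacency_matrix ::
    "'a list \<Rightarrow> 'a pair_pre_digraph \<Rightarrow> ('a \<times> 'a \<Rightarrow> complex) \<Rightarrow> complex mat" where
  "gain_adjacency_matrix vs G \<phi> = mat (length vs) (length vs)
     (\<lambda>(p, q). if (vs ! p, vs ! q) \<in> parcs G then \<phi> (vs ! p, vs ! q) else 0)"

text \<open>
  Eigenvalues are counted with multiplicity, here as roots of the characteristic polynomial;
  for Hermitian matrices this is also the dimension of the eigenspace.
\<close>

definition matrix_energy :: "complex mat \<Rightarrow> real" where
  "matrix_energy A = (\<Sum>x\<in>spectrum A. real (order x (char_poly A)) * cmod x)"

definition gain_energy ::
    "'a list \<Rightarrow> 'a pair_pre_digraph \<Rightarrow> ('a \<times> 'a \<Rightarrow> complex) \<Rightarrow> real" where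
  "gain_energy vs G \<phi> = matrix_energy (gain_adjacency_matrix vs G \<phi>)"

definition walk_gain :: "('b \<Rightarrow> complex) \<Rightarrow> 'b awalk \<Rightarrow> complex" where
  "walk_gain \<phi> p = prod_list (map \<phi> p)"

text \<open>
  In a symmetric digraph \<^const>\<open>pre_digraph.cycle\<close> also holds for the walks \<open>u, v, u\<close>,
  which are not cycles of the undirected graph; hence the length bound.
\<close>

definition balanced :: "('a, 'b) pre_digraph \<Rightarrow> ('b \<Rightarrow> complex) \<Rightarrow> bool" where
  "balanced G \<phi> \<longleftrightarrow> (\<forall>p. pre_digraph.cycle G p \<and> 3 \<le> length p \<longrightarrow> walk_gain \<phi> p = 1)"

definition edges :: "('a, 'b) pre_digraph \<Rightarrow> 'a set set" where
  "edges G = {{u, v} | u v. (u, v) \<in> arcs_ends G}"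

definition matching :: "('a, 'b) pre_digraph \<Rightarrow> 'a set set \<Rightarrow> bool" where
  "matching G M \<longleftrightarrow> M \<subseteq> edges G \<and> pairwise disjnt M"

definition matching_number :: "('a, 'b) pre_digraph \<Rightarrow> nat" where
  "matching_number G = Max {card M | M. matching G M}"

definition perfect_matching :: "('a, 'b) pre_digraph \<Rightarrow> 'a set set \<Rightarrow> bool" where
  "perfect_matching G M \<longleftrightarrow> matching G M \<and> \<Union>M = verts G"

text \<open>
  Connected components as maximal connected subgraphs. The name \<open>connected\<close> is qualified because
  it also denotes topological connectedness.
\<close>

definition components :: "('a, 'b) pre_digraph \<Rightarrow> ('a, 'b) pre_digraph set" where
  "components G = {H. pre_digraph.max_subgraph G Digraph_Component.connected H}"

text \<open>
  A complete bipartite graph with a perfect matching is exactly a \<open>K\<^bsub>p,p\<^esub>\<close>.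
\<close>

lemma complete_bipartite_perfect_matching_iff:
  assumes "verts H \<noteq> {}"
  shows "(\<exists>m n. complete_bipartite_digraph m n H \<and> (\<exists>M. perfect_matching H M)) \<longleftrightarrow>
         (\<exists>p\<ge>1. complete_bipartite_digraph p p H)"
proof
  assume "\<exists>m n. complete_bipartite_digraph m n H \<and> (\<exists>M. perfect_matching H M)"
  then obtain m n M where K: "complete_bipartite_digraph m n H" and M: "perfect_matching H M"
    by blast
  from K obtain U V where grH: "graph H" and UV: "verts H = U \<union> V" "U \<inter> V = {}"
      "card U = m" "card V = n" and ends: "arcs_ends H = U \<times> V \<union> V \<times> U"
    unfolding complete_bipartite_digraph_def by blast
  interpret graph H by (rule grH)
  have fin: "finite U" "finite V" using finite_verts UV(1) by auto
  have disj: "pairwise disjnt M" and sub: "M \<subseteq> edges H" and un: "\<Union>M = U \<union> V"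
    using M UV(1) by (simp_all add: perfect_matching_def matching_def)
  have "\<exists>u v. u \<in> U \<and> v \<in> V \<and> e = {u, v}" if "e \<in> M" for e
  proof -
    have "e \<in> edges H" using sub that by blast
    then obtain u v where "e = {u, v}" "(u, v) \<in> U \<times> V \<union> V \<times> U"
      unfolding edges_def ends by blast
    then show ?thesis by (auto simp: insert_commute)
  qed
  then have "\<forall>e\<in>M. \<exists>p. fst p \<in> U \<and> snd p \<in> V \<and> e = {fst p, snd p}" by fastforce
  from bchoice[OF this] obtain p where p: "\<forall>e\<in>M. fst (p e) \<in> U \<and> snd (p e) \<in> V \<and> e = {fst (p e), snd (p e)}"
    by blast
  define f g where "f = fst \<circ> p" and "g = snd \<circ> p"
  have fU: "f e \<in> U" and gV: "g e \<in> V" and fe: "f e \<in> e" and ge: "g e \<in> e"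
    and eUV: "x \<in> e \<Longrightarrow> x = f e \<or> x = g e" if "e \<in> M" for e x
    using p that by (auto simp: f_def g_def)
  have eq: "e = e'" if "e \<in> M" "e' \<in> M" "x \<in> e" "x \<in> e'" for e e' x
    using disj that by (auto simp: pairwise_def disjnt_def)
  have bf: "bij_betw f M U"
  proof (rule bij_betw_imageI)
    show "inj_on f M"
    proof (rule inj_onI)
      fix e e' assume e: "e \<in> M" "e' \<in> M" "f e = f e'"
      show "e = e'" using eq[OF e(1,2) fe[OF e(1)]] fe[OF e(2)] e(3) by simp
    qed
    have "u \<in> f ` M" if u: "u \<in> U" for u
    proof -
      obtain e where e: "e \<in> M" "u \<in> e" using un u by blast
      have "u \<noteq> g e" using gV[OF e(1)] UV(2) u by auto
      with eUV[OF e] have "u = f e" by simp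
      then show ?thesis using e(1) by simp
    qed
    then show "f ` M = U" using fU by blast
  qed
  have bg: "bij_betw g M V"
  proof (rule bij_betw_imageI)
    show "inj_on g M"
    proof (rule inj_onI)
      fix e e' assume e: "e \<in> M" "e' \<in> M" "g e = g e'"
      show "e = e'" using eq[OF e(1,2) ge[OF e(1)]] ge[OF e(2)] e(3) by simp
    qed
    have "u \<in> g ` M" if u: "u \<in> V" for u
    proof -
      obtain e where e: "e \<in> M" "u \<in> e" using un u by blast
      have "u \<noteq> f e" using fU[OF e(1)] UV(2) u by auto
      with eUV[OF e] have "u = g e" by simp
      then show ?thesis using e(1) by simp
    qed
    then show "g ` M = V" using gV by blast
  qed
  have mn: "m = n" using bij_betw_same_card[OF bf] bij_betw_same_card[OF bg] UV by simp
  moreover have "m \<ge> 1"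
    using assms UV mn fin by (cases m) auto
  ultimately show "\<exists>p\<ge>1. complete_bipartite_digraph p p H" using K by blast
next
  assume "\<exists>p\<ge>1. complete_bipartite_digraph p p H"
  then obtain p where K: "complete_bipartite_digraph p p H" by blast
  then obtain U V where grH: "graph H" and UV: "verts H = U \<union> V" "U \<inter> V = {}"
      "card U = p" "card V = p" and ends: "arcs_ends H = U \<times> V \<union> V \<times> U"
    unfolding complete_bipartite_digraph_def by blast
  interpret graph H by (rule grH)
  have fin: "finite U" "finite V" using finite_verts UV(1) by auto
  then obtain h where h: "bij_betw h U V" using UV finite_same_card_bij by metis
  have hV: "h u \<in> V" if "u \<in> U" for u using h that by (auto simp: bij_betw_def)
  have hs: "h ` U = V" and hi: "inj_on h U" using h by (auto simp: bij_betw_def)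
  let ?M = "(\<lambda>u. {u, h u}) ` U"
  have "pairwise disjnt ?M"
  proof (rule pairwiseI)
    fix a b assume "a \<in> ?M" "b \<in> ?M" "a \<noteq> b"
    then obtain u w where uw: "u \<in> U" "w \<in> U" "a = {u, h u}" "b = {w, h w}" by blast
    then have "u \<noteq> w" using \<open>a \<noteq> b\<close> by blast
    then have "h u \<noteq> h w" using uw hi by (auto dest: inj_onD)
    then show "disjnt a b"
      using uw \<open>u \<noteq> w\<close> hV[OF uw(1)] hV[OF uw(2)] UV(2) by (auto simp: disjnt_def)
  qed
  moreover have "?M \<subseteq> edges H" using hV by (auto simp: edges_def ends)
  moreover have "\<Union>?M = verts H" using hs UV(1) by auto
  ultimately have "perfect_matching H ?M" by (simp add: perfect_matching_def matching_def)
  with K show "\<exists>m n. complete_bipartite_digraph m n H \<and> (\<exists>M. perfect_matching H M)" by blast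
qed

end

theory Submission
  imports Defs
begin

text \<open>
  The energy of a Hermitian matrix \<open>A\<close> is its trace norm, so \<open>Re (tr (X A)) \<le> E(A)\<close> for every
  contraction \<open>X\<close>. A matching \<open>M\<close> with partner map \<open>m\<close> gives the contraction
  \<open>(X f)(w) = A(w, m w) f(m w)\<close> on matched vertices (and \<open>0\<close> elsewhere), for which
  \<open>tr (X A) = 2 |M|\<close>; hence \<open>E \<ge> 2 \<mu>\<close>. In case of equality \<open>X A = |A|\<close> is positive semidefinite
  with unit diagonal on matched vertices and entries of modulus \<open>0\<close> or \<open>1\<close>, so its rows at \<open>w\<close> and
  \<open>v\<close> are proportional whenever its \<open>(w, v)\<close> entry is nonzero. Read off on \<open>A\<close>, this says that
  every walk \<open>w, z, y, v\<close> closes to an edge \<open>w v\<close> whose gain is the gain of the walk, which together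
  with the perfect matching of the nonisolated vertices describes balanced \<open>K\<^bsub>p,p\<^esub>\<close>'s.
  Conversely, this closure property gives \<open>(A\<^sup>3 u)(w) = deg(w)\<^sup>2 (A u)(w)\<close>, so an eigenvector for
  \<open>\<lambda> \<noteq> 0\<close> lives on vertices of degree \<open>|\<lambda>|\<close>, and summing \<open>|\<lambda>\<^sub>i| |u\<^sub>i(w)|\<^sup>2\<close> over an orthonormal
  eigenbasis shows that every nonisolated vertex contributes \<open>1\<close> to the energy.
\<close>

section \<open>The spectral theorem for Hermitian matrices\<close>

definition adjoint :: "complex mat \<Rightarrow> complex mat" where
  "adjoint A = map_mat cnj (transpose_mat A)"

lemma adjoint_carrier [simp]: "A \<in> carrier_mat n m \<Longrightarrow> adjoint A \<in> carrier_mat m n"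
  by (auto simp: adjoint_def)

lemma adjoint_dim [simp]: "dim_row (adjoint A) = dim_col A" "dim_col (adjoint A) = dim_row A"
  by (auto simp: adjoint_def)

lemma adjoint_index [simp]: "i < dim_col A \<Longrightarrow> j < dim_row A \<Longrightarrow> adjoint A $$ (i, j) = cnj (A $$ (j, i))"
  by (auto simp: adjoint_def)

lemma adjoint_adjoint [simp]: "adjoint (adjoint A) = A"
  by (intro eq_matI) auto

lemma adjoint_mult:
  assumes "A \<in> carrier_mat n m" "B \<in> carrier_mat m k"
  shows "adjoint (A * B) = adjoint B * adjoint A"
  using assms by (intro eq_matI) (auto simp: scalar_prod_def mult.commute)

lemma adjoint_four_block_diag:
  assumes "A \<in> carrier_mat n n" "D \<in> carrier_mat m m"
  shows "adjoint (four_block_mat A (0\<^sub>m n m) (0\<^sub>m m n) D) = 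
    four_block_mat (adjoint A) (0\<^sub>m n m) (0\<^sub>m m n) (adjoint D)"
  using assms by (intro eq_matI) auto

lemma mult_four_block_diag:
  fixes A A' D D' :: "'a :: comm_ring_1 mat"
  assumes "A \<in> carrier_mat n n" "D \<in> carrier_mat m m" "A' \<in> carrier_mat n n" "D' \<in> carrier_mat m m"
  shows "four_block_mat A (0\<^sub>m n m) (0\<^sub>m m n) D * four_block_mat A' (0\<^sub>m n m) (0\<^sub>m m n) D' =
    four_block_mat (A * A') (0\<^sub>m n m) (0\<^sub>m m n) (D * D')"
  by (subst mult_four_block_mat[OF assms(1) _ _ assms(2) assms(3) _ _ assms(4)])
     (use assms in auto)

text \<open>Gram-Schmidt leaves the first vector of its input unchanged, so orthonormalising a
  completion of the eigenvector \<open>v\<close> to a basis gives a unitary matrix whose column 0 is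
  a multiple of \<open>v\<close>.\<close>

lemma exists_unitary_first_column:
  fixes A :: "complex mat"
  assumes A: "A \<in> carrier_mat n n" and ev: "eigenvector A v e"
  obtains W where "W \<in> carrier_mat n n" "adjoint W * W = 1\<^sub>m n" "A *\<^sub>v col W 0 = e \<cdot>\<^sub>v col W 0"
proof -
  from ev A have v: "v \<in> carrier_vec n" "v \<noteq> 0\<^sub>v n" and Av: "A *\<^sub>v v = e \<cdot>\<^sub>v v"
    by (auto simp: eigenvector_def)
  then have n: "0 < n" by (cases n) auto
  interpret cof_vec_space n "TYPE(complex)" .
  define b where "b = basis_completion v"
  note bc = basis_completion[OF v, folded b_def]
  define ws where "ws = gram_schmidt n b"
  obtain vs where bv: "b = v # vs" using bc n by (cases b) auto
  from gram_schmidt_result[OF bc(2,4,5) refl, folded ws_def] bc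
  have ws: "set ws \<subseteq> carrier_vec n" "corthogonal ws" "length ws = n" by auto
  have "hd ws = v" using gram_schmidt_hd[OF v(1), of vs, folded bv] unfolding ws_def .
  then have ws0: "ws ! 0 = v" using ws n by (cases ws) auto
  \<comment> \<open>\<open>c j\<close> is the squared length of the \<open>j\<close>-th Gram-Schmidt
    vector, a positive real; dividing by its square root normalises the columns of
    \<open>W\<close>.\<close>
  define c where "c j = Re (ws ! j \<bullet>c ws ! j)" for j
  have c: "ws ! j \<bullet>c ws ! j = complex_of_real (c j)" "c j > 0" if "j < n" for j
  proof -
    have wj: "ws ! j \<in> carrier_vec n" using ws that by (metis nth_mem subsetD)
    have "ws ! j \<bullet>c ws ! j \<noteq> 0" using corthogonalD[OF ws(2), of j j] ws that by auto
    moreover have S: "ws ! j \<bullet>c ws ! j = complex_of_real (\<Sum>i<n. (cmod (ws ! j $ i))\<^sup>2)"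
      using wj by (auto simp: scalar_prod_def complex_norm_square lessThan_atLeast0 simp del: of_real_power intro!: sum.cong)
    then have cj: "c j = (\<Sum>i<n. (cmod (ws ! j $ i))\<^sup>2)"
      by (simp only: c_def Re_complex_of_real)
    show eq: "ws ! j \<bullet>c ws ! j = complex_of_real (c j)"
      unfolding S cj ..
    have "c j \<ge> 0" unfolding cj by (intro sum_nonneg) auto
    moreover have "c j \<noteq> 0" using calculation eq by auto
    ultimately show "c j > 0" by simp
  qed
  define W where "W = mat n n (\<lambda>(i, j). complex_of_real (1 / sqrt (c j)) * (ws ! j $ i))"
  have W: "W \<in> carrier_mat n n" by (simp add: W_def)
  have colW: "col W j = complex_of_real (1 / sqrt (c j)) \<cdot>\<^sub>v ws ! j" if "j < n" for j
  proof -
    have "ws ! j \<in> carrier_vec n" using ws that by (metis nth_mem subsetD)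
    then show ?thesis using that by (intro eq_vecI) (auto simp: W_def)
  qed
  have "adjoint W * W = 1\<^sub>m n"
  proof (intro eq_matI)
    fix i j assume "i < dim_row (1\<^sub>m n :: complex mat)" "j < dim_col (1\<^sub>m n :: complex mat)"
    then have ij: "i < n" "j < n" by auto
    have wj: "ws ! j \<in> carrier_vec n" "ws ! i \<in> carrier_vec n" using ws ij by (metis nth_mem subsetD)+
    have "(adjoint W * W) $$ (i, j) = (\<Sum>k<n. cnj (W $$ (k, i)) * W $$ (k, j))"
      using ij W by (auto simp: scalar_prod_def lessThan_atLeast0)
    also have "\<dots> = complex_of_real (1 / sqrt (c i)) * complex_of_real (1 / sqrt (c j)) * (ws ! j \<bullet>c ws ! i)"
      using ij wj by (auto simp: W_def scalar_prod_def lessThan_atLeast0 sum_distrib_left intro!: sum.cong)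
    also have "\<dots> = (if i = j then 1 else 0)"
    proof (cases "i = j")
      case True
      have "complex_of_real (1 / sqrt (c i)) * complex_of_real (1 / sqrt (c i)) * complex_of_real (c i) 
        = complex_of_real (1 / sqrt (c i) * (1 / sqrt (c i)) * c i)" by (simp only: of_real_mult)
      also have "1 / sqrt (c i) * (1 / sqrt (c i)) * c i = 1"
        using c(2)[OF ij(1)] by (simp add: field_simps)
      finally show ?thesis using True c(1)[OF ij(1)] by simp
    next
      case False
      then have "ws ! j \<bullet>c ws ! i = 0" using corthogonalD[OF ws(2), of j i] ws ij by auto
      then show ?thesis using False by simp
    qed
    finally show "(adjoint W * W) $$ (i, j) = 1\<^sub>m n $$ (i, j)" using ij by simp
  qed (use W in auto)
  moreover have "A *\<^sub>v col W 0 = e \<cdot>\<^sub>v col W 0"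
    unfolding colW[OF n] ws0 using A v Av
    by (simp add: mult_mat_vec smult_smult_assoc mult.commute)
  ultimately show ?thesis using that W by blast
qed

text \<open>Deflation: conjugating with a unitary whose column 0 is an eigenvector clears the rest
  of column 0, self-adjointness clears the rest of row 0, and the induction hypothesis treats the
  remaining block. One list \<open>es\<close> serves both the factorisation and the diagonal, so
  multiplicities agree.\<close>

theorem hermitian_spectral:
  fixes A :: "complex mat"
  assumes "A \<in> carrier_mat n n" "adjoint A = A"
  shows "\<exists>es U. length es = n \<and> char_poly A = (\<Prod>e\<leftarrow>es. [:- e, 1:]) \<and> U \<in> carrier_mat n n
    \<and> adjoint U * U = 1\<^sub>m n \<and> A * U = U * mat n n (\<lambda>(i, j). if i = j then es ! i else 0)"
  using assms
proof (induction n arbitrary: A)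
  case 0
  then have A: "A \<in> carrier_mat 0 0" by simp
  have "char_poly A = 1"
    using degree_monic_char_poly[OF A] monic_degree_0[of "char_poly A"] by simp
  moreover have "adjoint (1\<^sub>m 0) * 1\<^sub>m 0 = (1\<^sub>m 0 :: complex mat)" by (rule eq_matI) simp_all
  moreover have "A * 1\<^sub>m 0 = 1\<^sub>m 0 * mat 0 0 (\<lambda>(i, j). if i = j then [] ! i else 0)"
    using A by (intro eq_matI) simp_all
  ultimately show ?case by (intro exI[of _ "[]"] exI[of _ "1\<^sub>m 0"]) simp
next
  case (Suc n)
  note A = Suc.prems(1)
  have "\<exists>e. eigenvalue A e"
  proof -
    have "degree (char_poly A) = Suc n" using degree_monic_char_poly[OF A] by simp
    then have "\<not> constant (poly (char_poly A))" by (simp add: constant_degree)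
    then show ?thesis using fundamental_theorem_of_algebra eigenvalue_root_char_poly[OF A] by blast
  qed
  then obtain e v where "eigenvector A v e" unfolding eigenvalue_def by blast
  then obtain W where W: "W \<in> carrier_mat (Suc n) (Suc n)" "adjoint W * W = 1\<^sub>m (Suc n)"
    and AW: "A *\<^sub>v col W 0 = e \<cdot>\<^sub>v col W 0"
    using exists_unitary_first_column[OF A] by metis
  have W': "adjoint W \<in> carrier_mat (Suc n) (Suc n)" using W by simp
  have WW: "W * adjoint W = 1\<^sub>m (Suc n)" using mat_mult_left_right_inverse[OF W' W(1) W(2)] .
  define A' where "A' = adjoint W * A * W"
  have A': "A' \<in> carrier_mat (Suc n) (Suc n)" unfolding A'_def by (rule mult_carrier_mat[OF mult_carrier_mat[OF W' A] W(1)])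
  have adA': "adjoint A' = A'"
    unfolding A'_def using W W' A Suc.prems(2)
    by (simp add: adjoint_mult[of _ "Suc n" "Suc n" _ "Suc n"] assoc_mult_mat[of _ "Suc n" "Suc n" _ "Suc n" _ "Suc n"])
  \<comment> \<open>Column 0 of \<open>A * W\<close> is \<open>e\<close> times column 0 of
    \<open>W\<close>, and \<open>adjoint W * W\<close> is the identity, so column 0 of
    \<open>A'\<close> is \<open>e\<close> times the first unit vector.\<close>
  have A'0: "A' $$ (i, 0) = (if i = 0 then e else 0)" if i: "i < Suc n" for i
  proof -
    have "A' $$ (i, 0) = row (adjoint W) i \<bullet> col (A * W) 0"
      unfolding A'_def assoc_mult_mat[OF W' A W(1)] using i W' A W by auto
    also have "col (A * W) 0 = e \<cdot>\<^sub>v col W 0" using AW by (subst col_mult2[OF A W(1)]) simp_all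
    also have "row (adjoint W) i \<bullet> (e \<cdot>\<^sub>v col W 0) = e * (adjoint W * W) $$ (i, 0)"
    proof -
      have "row (adjoint W) i \<in> carrier_vec (Suc n)" "col W 0 \<in> carrier_vec (Suc n)"
        by (auto intro!: carrier_vecI simp: carrier_matD[OF W(1)])
      moreover have "(adjoint W * W) $$ (i, 0) = row (adjoint W) i \<bullet> col W 0"
        by (rule index_mult_mat(1)) (use i in \<open>simp_all add: carrier_matD[OF W(1)]\<close>)
      ultimately show ?thesis by (simp add: scalar_prod_smult_distrib)
    qed
    finally show ?thesis using i unfolding W(2) by simp
  qed
  have A'0r: "A' $$ (0, i) = (if i = 0 then cnj e else 0)" if i: "i < Suc n" for i
    using A'0[OF i] adjoint_index[of 0 A' i] A' i unfolding adA' by auto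
  \<comment> \<open>The corner entry, read once from the column and once from the row, shows that
    \<open>e\<close> is real.\<close>
  have "cnj e = e" using A'0[of 0] A'0r[of 0] by simp
  define A1 where "A1 = mat 1 1 (\<lambda>_. e)"
  define A3 where "A3 = mat n n (\<lambda>(i, j). A' $$ (Suc i, Suc j))"
  have A1: "A1 \<in> carrier_mat 1 1" and A3: "A3 \<in> carrier_mat n n" by (auto simp: A1_def A3_def)
  have blk: "A' = four_block_mat A1 (0\<^sub>m 1 n) (0\<^sub>m n 1) A3"
    using A' by (intro eq_matI) (auto simp: A1_def A3_def A'0 A'0r \<open>cnj e = e\<close> less_Suc_eq_0_disj)
  have "adjoint A3 = A3"
  proof (intro eq_matI)
    fix i j assume "i < dim_row A3" "j < dim_col A3"
    then have ij: "i < n" "j < n" by (auto simp: A3_def)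
    then show "adjoint A3 $$ (i, j) = A3 $$ (i, j)"
      using adjoint_index[of "Suc i" A' "Suc j"] A' unfolding adA' by (simp add: A3_def)
  qed (auto simp: A3_def)
  from Suc.IH[OF A3 this] obtain es U where es: "length es = n" "char_poly A3 = (\<Prod>e\<leftarrow>es. [:- e, 1:])"
    and U: "U \<in> carrier_mat n n" "adjoint U * U = 1\<^sub>m n"
    and AU: "A3 * U = U * mat n n (\<lambda>(i, j). if i = j then es ! i else 0)" by blast
  \<comment> \<open>\<open>F\<close> extends the unitary \<open>U\<close> of the lower block by a
    fixed first coordinate, so that \<open>W * F\<close> diagonalises \<open>A\<close>.\<close>
  define F where "F = four_block_mat (1\<^sub>m 1) (0\<^sub>m 1 n) (0\<^sub>m n 1) U"
  define D where "D = mat (Suc n) (Suc n) (\<lambda>(i, j). if i = j then (e # es) ! i else 0)"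
  define D3 where "D3 = mat n n (\<lambda>(i, j). if i = j then es ! i else 0)"
  have D3: "D3 \<in> carrier_mat n n" by (simp add: D3_def)
  have Dblk: "D = four_block_mat A1 (0\<^sub>m 1 n) (0\<^sub>m n 1) D3"
    by (intro eq_matI) (auto simp: D_def D3_def A1_def less_Suc_eq_0_disj)
  have F: "F \<in> carrier_mat (Suc n) (Suc n)" using U by (auto simp: F_def)
  have D: "D \<in> carrier_mat (Suc n) (Suc n)" by (auto simp: D_def)
  have FF: "adjoint F * F = 1\<^sub>m (Suc n)"
    unfolding F_def adjoint_four_block_diag[OF one_carrier_mat U(1)]
    by (subst mult_four_block_diag) (use U in \<open>auto intro!: eq_matI\<close>)
  have A'F: "A' * F = F * D"
    unfolding blk F_def Dblk mult_four_block_diag[OF A1 A3 one_carrier_mat U(1)]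
      mult_four_block_diag[OF one_carrier_mat U(1) A1 D3] AU D3_def[symmetric]
    using A1 by simp
  have "similar_mat_wit A' A (adjoint W) W"
    by (rule similar_mat_witI[of _ _ "Suc n"]) (use W W' A A' WW A'_def in auto)
  then have "char_poly A = char_poly A'" 
    using char_poly_similar unfolding similar_mat_def by metis
  also have "\<dots> = char_poly A1 * char_poly A3"
    unfolding blk by (rule char_poly_four_block_zeros_col) (use A1 A3 in auto)
  also have "char_poly A1 = [:- e, 1:]"
    by (simp add: A1_def char_poly_defs det_def sign_def)
  finally have cp: "char_poly A = (\<Prod>e\<leftarrow>e # es. [:- e, 1:])" using es by simp
  have WF: "W * F \<in> carrier_mat (Suc n) (Suc n)" by (rule mult_carrier_mat[OF W(1) F])
  have "adjoint (W * F) * (W * F) = adjoint F * ((adjoint W * W) * F)"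
    using W(1) F W' by (simp add: adjoint_mult[of _ "Suc n" "Suc n" _ "Suc n"] assoc_mult_mat[of _ "Suc n" "Suc n" _ "Suc n" _ "Suc n"])
  also have "\<dots> = 1\<^sub>m (Suc n)" unfolding W(2) using F FF by simp
  finally have un: "adjoint (W * F) * (W * F) = 1\<^sub>m (Suc n)" .
  have "W * A' = (W * adjoint W) * (A * W)"
    unfolding A'_def using W(1) W' A by (simp add: assoc_mult_mat[of _ "Suc n" "Suc n" _ "Suc n" _ "Suc n"])
  also have "\<dots> = A * W" unfolding WW using A W by simp
  finally have WA': "W * A' = A * W" .
  have "A * (W * F) = A * W * F" using A W F by (simp add: assoc_mult_mat[of _ "Suc n" "Suc n" _ "Suc n" _ "Suc n"])
  also have "\<dots> = W * (A' * F)" unfolding WA'[symmetric] using A' W F by (simp add: assoc_mult_mat[of _ "Suc n" "Suc n" _ "Suc n" _ "Suc n"])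
  also have "\<dots> = W * F * D" unfolding A'F using D W F by (simp add: assoc_mult_mat[of _ "Suc n" "Suc n" _ "Suc n" _ "Suc n"])
  finally have "A * (W * F) = W * F * D" .
  with cp es WF un show ?case
    by (intro exI[of _ "e # es"] exI[of _ "W * F"]) (simp add: D_def)
qed


section \<open>Eigenbases and the trace norm\<close>

lemma order_prod_list_linear:
  fixes es :: "'b :: field list"
  shows "order x (\<Prod>e\<leftarrow>es. [:- e, 1:]) = count_list es x"
proof (induction es)
  case (Cons e es)
  have "(\<Prod>e\<leftarrow>es. [:- e, 1:]) \<noteq> 0" by (auto simp: prod_list_zero_iff)
  then have "order x (\<Prod>e\<leftarrow>e # es. [:- e, 1:]) = order x [:- e, 1:] + order x (\<Prod>e\<leftarrow>es. [:- e, 1:])"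
    by (simp add: order_mult del: mult_pCons_left)
  moreover have "order x [:- e, 1:] = (if e = x then 1 else 0)"
    using order_power_n_n[of x 1] by (auto intro: order_0I)
  ultimately show ?case using Cons by simp
qed simp

lemma sum_list_eq_sum_count_list:
  fixes f :: "'b \<Rightarrow> real"
  shows "(\<Sum>x\<leftarrow>xs. f x) = (\<Sum>x\<in>set xs. real (count_list xs x) * f x)"
proof (induction xs)
  case (Cons y xs)
  have "(\<Sum>x\<in>set (y # xs). real (count_list (y # xs) x) * f x)
    = (\<Sum>x\<in>set (y # xs). real (count_list xs x) * f x + (if x = y then f x else 0))"
    by (intro sum.cong) (auto simp: algebra_simps)
  also have "\<dots> = (\<Sum>x\<in>set (y # xs). real (count_list xs x) * f x) + f y"
    by (simp add: sum.distrib)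
  also have "(\<Sum>x\<in>set (y # xs). real (count_list xs x) * f x) = (\<Sum>x\<in>set xs. real (count_list xs x) * f x)"
    by (rule sum.mono_neutral_right) (auto simp: count_list_0_iff)
  finally show ?case using Cons by simp
qed simp

text \<open>The order of a root in a product of linear factors is the number of its occurrences
  among them, so weighting the spectrum by multiplicity amounts to summing over the list.\<close>

lemma matrix_energy_char_poly:
  assumes A: "A \<in> carrier_mat n n" and cp: "char_poly A = (\<Prod>e\<leftarrow>es. [:- e, 1:])"
  shows "matrix_energy A = (\<Sum>e\<leftarrow>es. cmod e)"
proof -
  have "spectrum A = set es"
    unfolding spectrum_def eigenvalue_root_char_poly[OF A] cp
    by (auto simp: poly_prod_list prod_list_zero_iff)
  then show ?thesis
    by (simp add: matrix_energy_def cp order_prod_list_linear sum_list_eq_sum_count_list)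
qed

section \<open>Orthonormal eigenbases of functions on the vertices\<close>

lemma norm_diff_sq: "(cmod (y - complex_of_real s * z))\<^sup>2 = (cmod y)\<^sup>2 - 2 * s * Re (y * cnj z) + s\<^sup>2 * (cmod z)\<^sup>2"
  unfolding cmod_power2 by (simp add: power2_eq_square algebra_simps)

text \<open>\<open>u i\<close> is column \<open>i\<close> of a unitary matrix \<open>U\<close> with
  rows indexed by \<open>V\<close>: \<open>unit\<close> is the diagonal of
  \<open>adjoint U * U = 1\<close>, and \<open>complete\<close> is
  \<open>U * adjoint U = 1\<close>.\<close>

locale hermitian_eigenbasis =
  fixes V :: "'a set" and a :: "'a \<Rightarrow> 'a \<Rightarrow> complex"
    and n :: nat and ev :: "nat \<Rightarrow> real" and u :: "nat \<Rightarrow> 'a \<Rightarrow> complex"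
  assumes finite_V: "finite V"
    and eigen: "\<lbrakk>i < n; w \<in> V\<rbrakk> \<Longrightarrow> (\<Sum>v\<in>V. a w v * u i v) = ev i * u i w"
    and unit: "i < n \<Longrightarrow> (\<Sum>v\<in>V. (cmod (u i v))\<^sup>2) = 1"
    and complete: "\<lbrakk>v \<in> V; w \<in> V\<rbrakk> \<Longrightarrow> (\<Sum>i<n. u i v * cnj (u i w)) = (if v = w then 1 else 0)"

text \<open>Transports the spectral theorem from matrix positions to vertices along the enumeration
  \<open>vs\<close>.\<close>

theorem exists_hermitian_eigenbasis:
  fixes a :: "'a \<Rightarrow> 'a \<Rightarrow> complex"
  assumes vs: "distinct vs" and herm: "\<And>v w. a v w = cnj (a w v)"
  defines "A \<equiv> mat (length vs) (length vs) (\<lambda>(p, q). a (vs ! p) (vs ! q))"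
  obtains ev u where "hermitian_eigenbasis (set vs) a (length vs) ev u"
    and "matrix_energy A = (\<Sum>i<length vs. \<bar>ev i\<bar>)"
proof -
  let ?n = "length vs"
  have A: "A \<in> carrier_mat ?n ?n" by (simp add: A_def)
  have adA: "adjoint A = A" by (intro eq_matI) (auto simp: A_def herm[symmetric])
  define D where "D es = mat ?n ?n (\<lambda>(i, j). if i = j then es ! i else 0 :: complex)" for es
  obtain es U where es: "length es = ?n" and cp: "char_poly A = (\<Prod>e\<leftarrow>es. [:- e, 1:])"
    and U: "U \<in> carrier_mat ?n ?n" and UU: "adjoint U * U = 1\<^sub>m ?n" and AU: "A * U = U * D es"
    using hermitian_spectral[OF A adA] unfolding D_def by blast
  have U': "adjoint U \<in> carrier_mat ?n ?n" and D: "D es \<in> carrier_mat ?n ?n"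
    using U by (simp_all add: D_def)
  have UU': "U * adjoint U = 1\<^sub>m ?n" using mat_mult_left_right_inverse[OF U' U UU] .
  have "D es = adjoint U * U * D es" unfolding UU using D by simp
  also have "\<dots> = adjoint U * A * U"
    using AU U U' A D by (simp add: assoc_mult_mat[of _ ?n ?n _ ?n _ ?n])
  \<comment> \<open>\<open>D es\<close> is conjugate to \<open>A\<close> by a unitary, hence
    self-adjoint, so its diagonal entries are real.\<close>
  finally have D_eq: "D es = adjoint U * A * U" .
  then have adD: "adjoint (D es) = D es"
    using U U' A adA by (simp add: adjoint_mult[of _ ?n ?n _ ?n] assoc_mult_mat[of _ ?n ?n _ ?n _ ?n])
  have real: "es ! i = complex_of_real (Re (es ! i))" if i: "i < ?n" for i
  proof -
    have "cnj (es ! i) = es ! i"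
      using adjoint_index[of i "D es" i] i unfolding adD by (simp add: D_def)
    then show ?thesis by (simp add: complex_eq_iff)
  qed
  \<comment> \<open>\<open>pos\<close> inverts the enumeration; distinctness of \<open>vs\<close>
    makes the position unique.\<close>
  define pos where "pos v = (THE p. p < ?n \<and> vs ! p = v)" for v
  have pos: "pos (vs ! p) = p" if "p < ?n" for p
    unfolding pos_def using that vs by (auto simp: nth_eq_iff_index_eq)
  have bij: "bij_betw (\<lambda>p. vs ! p) {..<?n} (set vs)"
    using bij_betw_nth[OF vs refl refl] .
  define u where "u i v = U $$ (pos v, i)" for i v
  have basis: "hermitian_eigenbasis (set vs) a ?n (\<lambda>i. Re (es ! i)) u"
  proof
    fix i w assume i: "i < ?n" and "w \<in> set vs"
    then obtain p where p: "p < ?n" "w = vs ! p" by (auto simp: in_set_conv_nth)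
    have "(\<Sum>v\<in>set vs. a w v * u i v) = (\<Sum>q<?n. A $$ (p, q) * U $$ (q, i))"
      by (subst sum.reindex_bij_betw[OF bij, symmetric])
         (use p pos in \<open>auto simp: u_def A_def intro!: sum.cong\<close>)
    also have "\<dots> = (A * U) $$ (p, i)"
      using p i A U by (auto simp: scalar_prod_def lessThan_atLeast0)
    also have "\<dots> = (\<Sum>q<?n. U $$ (p, q) * (if q = i then es ! q else 0))"
      unfolding AU using p i U D by (auto simp: D_def scalar_prod_def lessThan_atLeast0 intro!: sum.cong)
    also have "\<dots> = (\<Sum>q<?n. if q = i then U $$ (p, q) * es ! q else 0)"
      by (intro sum.cong) auto
    also have "\<dots> = es ! i * u i w" using i p by (simp add: u_def pos)
    finally show "(\<Sum>v\<in>set vs. a w v * u i v) = complex_of_real (Re (es ! i)) * u i w"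
      using real[OF i] by simp
  next
    fix i assume i: "i < ?n"
    have "complex_of_real (\<Sum>v\<in>set vs. (cmod (u i v))\<^sup>2) = (\<Sum>q<?n. cnj (U $$ (q, i)) * U $$ (q, i))"
      unfolding of_real_sum
      by (subst sum.reindex_bij_betw[OF bij, symmetric])
         (use pos in \<open>auto simp: u_def complex_norm_square mult.commute simp del: of_real_power intro!: sum.cong\<close>)
    also have "\<dots> = (adjoint U * U) $$ (i, i)"
      using i U by (auto simp: scalar_prod_def lessThan_atLeast0)
    also have "\<dots> = complex_of_real 1" using i by (simp add: UU)
    finally show "(\<Sum>v\<in>set vs. (cmod (u i v))\<^sup>2) = 1" unfolding of_real_eq_iff .
  next
    fix v w assume "v \<in> set vs" "w \<in> set vs"
    then obtain p q where pq: "p < ?n" "v = vs ! p" "q < ?n" "w = vs ! q" by (auto simp: in_set_conv_nth)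
    have "(\<Sum>i<?n. u i v * cnj (u i w)) = (U * adjoint U) $$ (p, q)"
      using pq U pos by (auto simp: u_def scalar_prod_def lessThan_atLeast0)
    also have "\<dots> = (if v = w then 1 else 0)"
      using pq vs by (simp add: UU' nth_eq_iff_index_eq)
    finally show "(\<Sum>i<?n. u i v * cnj (u i w)) = (if v = w then 1 else 0)" .
  qed simp
  have "matrix_energy A = (\<Sum>e\<leftarrow>es. cmod e)" by (rule matrix_energy_char_poly[OF A cp])
  also have "\<dots> = (\<Sum>i<?n. cmod (es ! i))" by (simp add: sum_list_sum_nth es lessThan_atLeast0)
  also have "\<dots> = (\<Sum>i<?n. \<bar>Re (es ! i)\<bar>)" using real by (intro sum.cong) (auto, metis norm_of_real)
  finally show ?thesis using that basis by blast
qed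

context hermitian_eigenbasis
begin

text \<open>Spectral decomposition: pick out the column by a Kronecker delta, expand the delta by
  \<open>complete\<close>, and apply \<open>eigen\<close>.\<close>

lemma expansion:
  assumes "w \<in> V" "v \<in> V"
  shows "a w v = (\<Sum>i<n. ev i * u i w * cnj (u i v))"
proof -
  have "a w v = (\<Sum>z\<in>V. a w z * (if z = v then 1 else 0))"
    using assms finite_V by (simp add: if_distrib[of "(*) _"] sum.delta cong: if_cong)
  also have "\<dots> = (\<Sum>z\<in>V. \<Sum>i<n. a w z * u i z * cnj (u i v))"
    using assms by (intro sum.cong) (simp_all add: complete[symmetric] sum_distrib_left mult.assoc del: mult_cancel_left)
  also have "\<dots> = (\<Sum>i<n. (\<Sum>z\<in>V. a w z * u i z) * cnj (u i v))"
    by (subst sum.swap) (simp add: sum_distrib_right)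
  also have "\<dots> = (\<Sum>i<n. ev i * u i w * cnj (u i v))"
    using assms by (intro sum.cong) (simp_all add: eigen)
  finally show ?thesis .
qed

text \<open>Here \<open>y i\<close> stands for the image of the eigenvector \<open>u i\<close> under a contraction, and the
  real part on the right is the real part of the trace of the contraction times \<open>a\<close>.\<close>

lemma contraction_defect:
  assumes y: "\<And>i. i < n \<Longrightarrow> (\<Sum>v\<in>V. (cmod (y i v))\<^sup>2) \<le> 1"
  shows "(\<Sum>i<n. \<bar>ev i\<bar> * (\<Sum>v\<in>V. (cmod (y i v - complex_of_real (sgn (ev i)) * u i v))\<^sup>2))
    \<le> 2 * ((\<Sum>i<n. \<bar>ev i\<bar>) - Re (\<Sum>i<n. ev i * (\<Sum>v\<in>V. y i v * cnj (u i v))))"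
proof -
  \<comment> \<open>For a single index, expanding the square bounds it by
    \<open>2 - 2 * ?s * ?c\<close>, as both vectors have norm at most 1 and \<open>?s\<close> has
    modulus at most 1. The weight then turns \<open>?s\<close> into \<open>ev i\<close>; for
    \<open>ev i = 0\<close> both sides vanish.\<close>
  have "\<bar>ev i\<bar> * (\<Sum>v\<in>V. (cmod (y i v - complex_of_real (sgn (ev i)) * u i v))\<^sup>2)
    \<le> 2 * (\<bar>ev i\<bar> - Re (ev i * (\<Sum>v\<in>V. y i v * cnj (u i v))))" if i: "i < n" for i
  proof -
    let ?s = "sgn (ev i)" and ?c = "Re (\<Sum>v\<in>V. y i v * cnj (u i v))"
    have "(\<Sum>v\<in>V. (cmod (y i v - complex_of_real ?s * u i v))\<^sup>2)
      = (\<Sum>v\<in>V. (cmod (y i v))\<^sup>2) - 2 * ?s * ?c + ?s\<^sup>2 * (\<Sum>v\<in>V. (cmod (u i v))\<^sup>2)"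
      by (simp only: norm_diff_sq Re_sum sum.distrib sum_subtractf sum_distrib_left)
    also have "\<dots> \<le> 2 - 2 * ?s * ?c"
      using y[OF i] unit[OF i] by (simp add: sgn_if)
    finally have "\<bar>ev i\<bar> * (\<Sum>v\<in>V. (cmod (y i v - complex_of_real ?s * u i v))\<^sup>2)
      \<le> \<bar>ev i\<bar> * (2 - 2 * ?s * ?c)" by (rule mult_left_mono) simp
    also have "\<dots> = 2 * (\<bar>ev i\<bar> - (\<bar>ev i\<bar> * ?s) * ?c)" by (simp add: algebra_simps)
    also have "\<bar>ev i\<bar> * ?s = ev i" by (simp add: abs_mult_sgn)
    finally show ?thesis by simp
  qed
  then have "(\<Sum>i<n. \<bar>ev i\<bar> * (\<Sum>v\<in>V. (cmod (y i v - complex_of_real (sgn (ev i)) * u i v))\<^sup>2))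
    \<le> (\<Sum>i<n. 2 * (\<bar>ev i\<bar> - Re (ev i * (\<Sum>v\<in>V. y i v * cnj (u i v)))))"
    by (intro sum_mono) simp
  also have "\<dots> = 2 * ((\<Sum>i<n. \<bar>ev i\<bar>) - Re (\<Sum>i<n. ev i * (\<Sum>v\<in>V. y i v * cnj (u i v))))"
    by (simp add: sum_distrib_left[symmetric] sum_subtractf)
  finally show ?thesis .
qed

text \<open>The entries of the absolute value (positive square root of the square) of \<open>a\<close>.\<close>

definition abs_entry :: "'a \<Rightarrow> 'a \<Rightarrow> complex" where
  "abs_entry w v = (\<Sum>i<n. \<bar>ev i\<bar> * u i w * cnj (u i v))"

lemma abs_entry_cnj: "abs_entry v w = cnj (abs_entry w v)"
  by (simp add: abs_entry_def mult_ac)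

text \<open>The squared norm of the difference of row \<open>w\<close> and \<open>abs_entry w v\<close> times row \<open>v\<close> in the Gram
  representation is \<open>1 - 2 + 1 = 0\<close>.\<close>

lemma abs_entry_mult:
  assumes "abs_entry w w = 1" "abs_entry v v = 1" "cmod (abs_entry w v) = 1"
  shows "abs_entry w z = abs_entry w v * abs_entry v z"
proof -
  let ?b = "abs_entry w v"
  have "complex_of_real (\<Sum>i<n. \<bar>ev i\<bar> * (cmod (u i w - ?b * u i v))\<^sup>2)
    = (\<Sum>i<n. \<bar>ev i\<bar> * ((u i w - ?b * u i v) * cnj (u i w - ?b * u i v)))"
    by (simp only: of_real_sum of_real_mult complex_norm_square)
  also have "\<dots> = (\<Sum>i<n. \<bar>ev i\<bar> * u i w * cnj (u i w) - cnj ?b * (\<bar>ev i\<bar> * u i w * cnj (u i v))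
      - ?b * (\<bar>ev i\<bar> * u i v * cnj (u i w)) + ?b * cnj ?b * (\<bar>ev i\<bar> * u i v * cnj (u i v)))"
    by (intro sum.cong) (simp_all add: algebra_simps)
  also have "\<dots> = abs_entry w w - cnj ?b * ?b - ?b * abs_entry v w + ?b * cnj ?b * abs_entry v v"
    by (simp only: sum.distrib sum_subtractf sum_distrib_left[symmetric] abs_entry_def)
  also have "\<dots> = 1 - ?b * cnj ?b" by (simp add: assms(1,2) abs_entry_cnj[of v w])
  also have "?b * cnj ?b = 1" using assms(3) by (metis complex_norm_square of_real_1 one_power2)
  finally have "(\<Sum>i<n. \<bar>ev i\<bar> * (cmod (u i w - ?b * u i v))\<^sup>2) = 0" by (simp only: of_real_eq_0_iff diff_self)
  \<comment> \<open>In a vanishing sum of nonnegative terms every term is 0, so each index with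
    nonzero eigenvalue has \<open>u i w\<close> proportional to \<open>u i v\<close> with the same
    factor; the other indices contribute nothing to \<open>abs_entry\<close>.\<close>
  then have *: "\<bar>ev i\<bar> = 0 \<or> u i w = ?b * u i v" if "i < n" for i
    using that by (subst (asm) sum_nonneg_eq_0_iff) auto
  have "\<bar>ev i\<bar> * u i w * cnj (u i z) = ?b * (\<bar>ev i\<bar> * u i v * cnj (u i z))" if "i < n" for i
    using *[OF that] by auto
  then show ?thesis
    unfolding abs_entry_def[of w z] abs_entry_def[of v z] sum_distrib_left by (intro sum.cong) auto
qed

end

section \<open>The contraction given by a matching\<close>

locale matched_eigenbasis = hermitian_eigenbasis +
  fixes S :: "'a set" and m :: "'a \<Rightarrow> 'a"
  assumes herm: "a v w = cnj (a w v)"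
    and S: "S \<subseteq> V" and m: "w \<in> S \<Longrightarrow> m w \<in> S" "w \<in> S \<Longrightarrow> m (m w) = w"
    and unit_match: "w \<in> S \<Longrightarrow> cmod (a w (m w)) = 1"
begin

text \<open>\<open>S\<close> stands for the matched vertices and \<open>m\<close> for the partner
  map. As \<open>m\<close> permutes \<open>S\<close> and the factors \<open>a w (m w)\<close> have
  modulus 1, the norm over \<open>S\<close> is kept and only the part outside \<open>S\<close> is
  lost.\<close>

lemma reflection_norm: 
  assumes "i < n"
  shows "(\<Sum>w\<in>V. (cmod (if w \<in> S then a w (m w) * u i (m w) else 0))\<^sup>2) \<le> 1"
proof -
  have bij: "bij_betw m S S" by (rule bij_betw_byWitness[of _ m]) (use m in auto)
  have "(\<Sum>w\<in>V. (cmod (if w \<in> S then a w (m w) * u i (m w) else 0))\<^sup>2) = (\<Sum>w\<in>S. (cmod (u i (m w)))\<^sup>2)"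
    using S finite_V by (intro sum.mono_neutral_cong_right) (auto simp: norm_mult unit_match)
  also have "\<dots> = (\<Sum>w\<in>S. (cmod (u i w))\<^sup>2)" by (rule sum.reindex_bij_betw[OF bij])
  also have "\<dots> \<le> (\<Sum>w\<in>V. (cmod (u i w))\<^sup>2)" using S finite_V by (intro sum_mono2) auto
  finally show ?thesis using unit[OF assms] by simp
qed

text \<open>The left side is the trace of the contraction times \<open>a\<close>. By
  \<open>expansion\<close> the sum over \<open>i\<close> collapses to \<open>a (m w) w\<close>, the
  conjugate of \<open>a w (m w)\<close>, so each matched vertex contributes 1.\<close>

lemma reflection_trace:
  "(\<Sum>i<n. ev i * (\<Sum>w\<in>V. (if w \<in> S then a w (m w) * u i (m w) else 0) * cnj (u i w))) = of_nat (card S)"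
proof -
  have "(\<Sum>w\<in>V. (if w \<in> S then a w (m w) * u i (m w) else 0) * cnj (u i w))
    = (\<Sum>w\<in>S. a w (m w) * u i (m w) * cnj (u i w))" for i
    using S finite_V by (intro sum.mono_neutral_cong_right) auto
  then have "(\<Sum>i<n. ev i * (\<Sum>w\<in>V. (if w \<in> S then a w (m w) * u i (m w) else 0) * cnj (u i w)))
    = (\<Sum>w\<in>S. a w (m w) * (\<Sum>i<n. ev i * u i (m w) * cnj (u i w)))"
    by (simp add: sum_distrib_left sum.swap[of _ S] mult_ac)
  also have "\<dots> = (\<Sum>w\<in>S. a w (m w) * a (m w) w)"
    using S m by (intro sum.cong) (simp_all add: expansion[symmetric] subset_iff)
  also have "\<dots> = (\<Sum>w\<in>S. 1)"
  proof (intro sum.cong refl)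
    fix w assume "w \<in> S"
    then show "a w (m w) * a (m w) w = 1"
      using unit_match[of w] herm[of "m w" w] by (metis complex_norm_square of_real_1 one_power2)
  qed
  finally show ?thesis by simp
qed

text \<open>The weighted sum of squares in \<open>contraction_defect\<close> is nonnegative, and the
  trace in its bound is \<open>card S\<close>.\<close>

lemma card_le_sum_abs: "real (card S) \<le> (\<Sum>i<n. \<bar>ev i\<bar>)"
proof -
  let ?y = "\<lambda>i w. if w \<in> S then a w (m w) * u i (m w) else 0"
  have "0 \<le> (\<Sum>i<n. \<bar>ev i\<bar> * (\<Sum>v\<in>V. (cmod (?y i v - complex_of_real (sgn (ev i)) * u i v))\<^sup>2))"
    by (intro sum_nonneg mult_nonneg_nonneg) auto
  also have "\<dots> \<le> 2 * ((\<Sum>i<n. \<bar>ev i\<bar>) - Re (\<Sum>i<n. ev i * (\<Sum>v\<in>V. ?y i v * cnj (u i v))))"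
    by (rule contraction_defect) (rule reflection_norm)
  finally show ?thesis unfolding reflection_trace by simp
qed

text \<open>Equality makes the defect vanish, so the contraction sends \<open>u i\<close> to
  \<open>sgn (ev i)\<close> times \<open>u i\<close> whenever \<open>ev i\<close> is nonzero.
  Multiplying by \<open>ev i\<close> and expanding identifies the contraction times \<open>a\<close>
  with the absolute value of \<open>a\<close>.\<close>

lemma abs_entry_eq:
  assumes eq: "real (card S) = (\<Sum>i<n. \<bar>ev i\<bar>)" and wv: "w \<in> V" "v \<in> V"
  shows "abs_entry w v = (if w \<in> S then a w (m w) * a (m w) v else 0)"
proof -
  let ?y = "\<lambda>i w. if w \<in> S then a w (m w) * u i (m w) else 0"
  let ?d = "\<lambda>i. \<Sum>v\<in>V. (cmod (?y i v - complex_of_real (sgn (ev i)) * u i v))\<^sup>2"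
  have d: "?d i \<ge> 0" for i by (intro sum_nonneg) auto
  have "(\<Sum>i<n. \<bar>ev i\<bar> * ?d i)
     \<le> 2 * ((\<Sum>i<n. \<bar>ev i\<bar>) - Re (\<Sum>i<n. ev i * (\<Sum>v\<in>V. ?y i v * cnj (u i v))))"
    by (rule contraction_defect) (rule reflection_norm)
  then have "(\<Sum>i<n. \<bar>ev i\<bar> * ?d i) \<le> 0"
    unfolding reflection_trace eq[symmetric] by simp
  moreover have "(\<Sum>i<n. \<bar>ev i\<bar> * ?d i) \<ge> 0"
    by (intro sum_nonneg mult_nonneg_nonneg d) auto
  ultimately have "(\<Sum>i<n. \<bar>ev i\<bar> * ?d i) = 0" by simp
  then have "\<bar>ev i\<bar> * ?d i = 0" if "i < n" for i
    using that d by (subst (asm) sum_nonneg_eq_0_iff) auto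
  then have "ev i = 0 \<or> ?d i = 0" if "i < n" for i
    using that by fastforce
  moreover have "?d i = 0 \<longleftrightarrow> (\<forall>x\<in>V. ?y i x = sgn (ev i) * u i x)" for i
    by (subst sum_nonneg_eq_0_iff) (use finite_V in auto)
  ultimately have *: "ev i = 0 \<or> ?y i w = sgn (ev i) * u i w" if "i < n" for i
    using that wv(1) by blast
  have "ev i * ?y i w = \<bar>ev i\<bar> * u i w" if "i < n" for i
  proof -
    have "complex_of_real (ev i) * complex_of_real (sgn (ev i)) = complex_of_real \<bar>ev i\<bar>"
      by (simp only: of_real_mult[symmetric] abs_sgn)
    then have "ev i * (sgn (ev i) * u i w) = \<bar>ev i\<bar> * u i w" by (simp only: mult.assoc[symmetric])
    with *[OF that] show ?thesis by (elim disjE) (simp_all only: abs_zero of_real_0 mult_zero_left)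
  qed
  then have "abs_entry w v = (\<Sum>i<n. ev i * ?y i w * cnj (u i v))"
    unfolding abs_entry_def by (intro sum.cong) auto
  also have "\<dots> = (if w \<in> S then a w (m w) * (\<Sum>i<n. ev i * u i (m w) * cnj (u i v)) else 0)"
    by (simp add: sum_distrib_left mult_ac)
  also have "\<dots> = (if w \<in> S then a w (m w) * a (m w) v else 0)"
    using S m(1)[of w] wv expansion[of "m w" v] by auto
  finally show ?thesis .
qed

end


section \<open>Energy and matchings\<close>

context gain_graph
begin

definition adj :: "'a \<Rightarrow> 'a \<Rightarrow> complex" where
  "adj w v = (if (w, v) \<in> parcs G then \<phi> (w, v) else 0)"

lemma arcs_sym: "(w, v) \<in> parcs G \<Longrightarrow> (v, w) \<in> parcs G"
  using graph_symmetric by blast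

lemma arc_irrefl: "(w, w) \<notin> parcs G"
  using no_loops' by blast

lemma cmod_adj: "cmod (adj w v) = (if (w, v) \<in> parcs G then 1 else 0)"
  by (simp add: adj_def gain_unit)

lemma adj_eq_0_iff: "adj w v = 0 \<longleftrightarrow> (w, v) \<notin> parcs G"
  using cmod_adj[of w v] by (auto split: if_splits)

lemma adj_cnj: "adj w v = cnj (adj v w)"
proof (cases "(v, w) \<in> parcs G")
  case True
  then have "\<phi> (v, w) * cnj (\<phi> (v, w)) = 1"
    using gain_unit by (simp add: complex_norm_square[symmetric])
  then show ?thesis
    using True gain_rev[OF True] arcs_sym[OF True] by (simp add: adj_def inverse_unique)
next
  case False
  then show ?thesis using arcs_sym by (auto simp: adj_def)
qed

lemma adj_mult_adj: "adj w v * adj v w = (if (w, v) \<in> parcs G then 1 else 0)"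
  unfolding adj_cnj[of v w] complex_norm_square[symmetric] cmod_adj by simp

lemma exists_adj_eigenbasis:
  assumes "distinct vs" "set vs = pverts G"
  obtains ev u where "hermitian_eigenbasis (pverts G) adj (length vs) ev u"
    and "gain_energy vs G \<phi> = (\<Sum>i<length vs. \<bar>ev i\<bar>)"
proof (rule exists_hermitian_eigenbasis[OF assms(1) adj_cnj])
  fix ev u assume *: "hermitian_eigenbasis (set vs) adj (length vs) ev u"
    and en: "matrix_energy (mat (length vs) (length vs) (\<lambda>(p, q). adj (vs ! p) (vs ! q))) = (\<Sum>i<length vs. \<bar>ev i\<bar>)"
  have "gain_adjacency_matrix vs G \<phi> = mat (length vs) (length vs) (\<lambda>(p, q). adj (vs ! p) (vs ! q))"
    by (simp add: gain_adjacency_matrix_def adj_def)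
  with * en show ?thesis using that assms(2) by (simp add: gain_energy_def)
qed

definition covers_nonisolated :: "'a set set \<Rightarrow> bool" where
  "covers_nonisolated M \<longleftrightarrow> (\<forall>w v. (w, v) \<in> parcs G \<longrightarrow> w \<in> \<Union>M)"

text \<open>Walks may repeat vertices. For \<open>w = y\<close> or \<open>z = v\<close> the
  condition holds automatically; \<open>w = v\<close> would demand a loop, so triangles are
  excluded.\<close>

definition three_walks_close :: bool where
  "three_walks_close \<longleftrightarrow> (\<forall>w z y v. (w, z) \<in> parcs G \<longrightarrow> (z, y) \<in> parcs G \<longrightarrow> (y, v) \<in> parcs G \<longrightarrow>
    (w, v) \<in> parcs G \<and> \<phi> (w, v) = \<phi> (w, z) * \<phi> (z, y) * \<phi> (y, v))"

section \<open>Matchings and their partner maps\<close>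

lemma edges_conv: "edges (with_proj G) = {{w, v} | w v. (w, v) \<in> parcs G}"
  by (simp add: edges_def)

lemma finite_edges: "finite (edges (with_proj G))"
proof -
  have "edges (with_proj G) = (\<lambda>(w, v). {w, v}) ` parcs G" by (auto simp: edges_conv)
  then show ?thesis using pair_finite_arcs by simp
qed

lemma finite_matching: "matching (with_proj G) M \<Longrightarrow> finite M"
  using finite_edges finite_subset by (auto simp: matching_def)

lemma finite_matching_cards: "finite {card M | M. matching (with_proj G) M}"
proof -
  have "{card M | M. matching (with_proj G) M} \<subseteq> card ` Pow (edges (with_proj G))"
    by (auto simp: matching_def)
  then show ?thesis using finite_edges finite_subset by blast
qed

lemma card_le_matching_number: "matching (with_proj G) M \<Longrightarrow> card M \<le> matching_number (with_proj G)"
  unfolding matching_number_def by (rule Max_ge[OF finite_matching_cards]) blast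

lemma exists_maximum_matching:
  obtains M where "matching (with_proj G) M" "card M = matching_number (with_proj G)"
proof -
  have "matching (with_proj G) {}" by (simp add: matching_def)
  then have "{card M | M. matching (with_proj G) M} \<noteq> {}" by blast
  from Max_in[OF finite_matching_cards this] that show ?thesis
    unfolding matching_number_def by auto
qed

lemma card_Union_matching:
  assumes "matching (with_proj G) M"
  shows "card (\<Union>M) = 2 * card M"
proof -
  have e2: "finite e \<and> card e = 2" if "e \<in> M" for e
  proof -
    from that assms have "e \<in> edges (with_proj G)" unfolding matching_def by blast
    then obtain w v where "e = {w, v}" "(w, v) \<in> parcs G"
      unfolding edges_conv by blast
    then show ?thesis using no_loops' by (simp add: card_insert_if)
  qed
  have "card (\<Union>M) = sum card M"
    using assms e2 by (intro card_Union_disjoint) (auto simp: matching_def)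
  then show ?thesis using e2 by simp
qed

lemma Union_matching_subset: "matching (with_proj G) M \<Longrightarrow> \<Union>M \<subseteq> pverts G"
  using in_arcsD1 in_arcsD2 by (fastforce simp: matching_def edges_conv)

lemma matching_partner:
  assumes M: "matching (with_proj G) M"
  obtains m where "\<And>w. w \<in> \<Union>M \<Longrightarrow> {w, m w} \<in> M" "\<And>w. w \<in> \<Union>M \<Longrightarrow> m w \<in> \<Union>M"
    "\<And>w. w \<in> \<Union>M \<Longrightarrow> m (m w) = w" "\<And>w. w \<in> \<Union>M \<Longrightarrow> (w, m w) \<in> parcs G"
proof -
  have arc: "(w, v) \<in> parcs G" if "{w, v} \<in> M" for w v
  proof -
    from that M obtain x y where "{w, v} = {x, y}" "(x, y) \<in> parcs G"
      by (fastforce simp: matching_def edges_conv)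
    then show ?thesis using arcs_sym by (auto simp: doubleton_eq_iff)
  qed
  have uniq: "v = v'" if vv: "{w, v} \<in> M" "{w, v'} \<in> M" for w v v'
  proof -
    have "{w, v} = {w, v'}" using vv M unfolding matching_def by (metis disjnt_iff insertI1 pairwiseD)
    then show ?thesis by (auto simp: doubleton_eq_iff)
  qed
  have ex: "\<exists>v. {w, v} \<in> M" if "w \<in> \<Union>M" for w
  proof -
    obtain e where e: "e \<in> M" "w \<in> e" using \<open>w \<in> \<Union>M\<close> by blast
    then obtain x y where "e = {x, y}" using M by (auto simp: matching_def edges_conv)
    then have "e = {w, x} \<or> e = {w, y}" using e by auto
    then show ?thesis using e by blast
  qed
  \<comment> \<open>Disjointness makes the chosen partner unique on \<open>\<Union>M\<close>, which
    turns \<open>m\<close> into an involution there; elsewhere its value is arbitrary.\<close>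
  define m where "m w = (SOME v. {w, v} \<in> M)" for w
  have m: "{w, m w} \<in> M" if "w \<in> \<Union>M" for w
    unfolding m_def using ex[OF that] by (rule someI_ex)
  have m': "m w \<in> \<Union>M" if "w \<in> \<Union>M" for w using m[OF that] by blast
  have "m (m w) = w" if "w \<in> \<Union>M" for w
    using uniq[of "m w" "m (m w)" w] m[OF m'[OF that]] m[OF that] by (simp add: insert_commute)
  with m m' arc that show ?thesis by blast
qed

lemma matched_eigenbasisI:
  assumes "hermitian_eigenbasis (pverts G) adj n ev u" "matching (with_proj G) M"
    and "\<And>w. w \<in> \<Union>M \<Longrightarrow> m w \<in> \<Union>M" "\<And>w. w \<in> \<Union>M \<Longrightarrow> m (m w) = w"
    and "\<And>w. w \<in> \<Union>M \<Longrightarrow> (w, m w) \<in> parcs G"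
  shows "matched_eigenbasis (pverts G) adj n ev u (\<Union>M) m"
proof -
  interpret hermitian_eigenbasis "pverts G" adj n ev u by fact
  show ?thesis
    using assms(3-5) Union_matching_subset[OF assms(2)]
    by unfold_locales (auto simp: cmod_adj adj_cnj[symmetric])
qed

section \<open>The lower bound and its equality case\<close>

lemma matching_number_le_energy:
  assumes "distinct vs" "set vs = pverts G"
  shows "2 * real (matching_number (with_proj G)) \<le> gain_energy vs G \<phi>"
proof -
  obtain ev u where B: "hermitian_eigenbasis (pverts G) adj (length vs) ev u"
    and en: "gain_energy vs G \<phi> = (\<Sum>i<length vs. \<bar>ev i\<bar>)"
    by (rule exists_adj_eigenbasis[OF assms])
  obtain M where M: "matching (with_proj G) M" "card M = matching_number (with_proj G)"
    by (rule exists_maximum_matching)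
  obtain m where m: "\<And>w. w \<in> \<Union>M \<Longrightarrow> m w \<in> \<Union>M" "\<And>w. w \<in> \<Union>M \<Longrightarrow> m (m w) = w"
      "\<And>w. w \<in> \<Union>M \<Longrightarrow> (w, m w) \<in> parcs G"
    using matching_partner[OF M(1)] by metis
  show ?thesis
    using matched_eigenbasis.card_le_sum_abs[OF matched_eigenbasisI[OF B M(1) m]]
    by (simp add: card_Union_matching[OF M(1)] M(2) en)
qed

text \<open>An edge with both ends uncovered could be added to the matching.\<close>

lemma maximum_matching_covers:
  assumes M: "matching (with_proj G) M" "card M = matching_number (with_proj G)" and wv: "(w, v) \<in> parcs G"
  shows "w \<in> \<Union>M \<or> v \<in> \<Union>M"
proof (rule ccontr)
  assume *: "\<not> ?thesis"
  then have "{w, v} \<notin> M" by auto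
  moreover have "matching (with_proj G) (insert {w, v} M)"
    using * M(1) wv by (auto simp: matching_def pairwise_insert disjnt_def edges_conv)
  ultimately show False
    using card_le_matching_number[of "insert {w, v} M"] M(2) finite_matching[OF M(1)] by simp
qed

text \<open>For a maximum matching, equality yields the entries of the absolute value explicitly
  (\<open>B\<close>). Its Hermitian symmetry gives coverage, and the proportionality of its rows
  gives the closure of walks.\<close>

theorem energy_eq_imp:
  assumes vs: "distinct vs" "set vs = pverts G"
    and eq: "gain_energy vs G \<phi> = 2 * real (matching_number (with_proj G))"
  shows "three_walks_close \<and> (\<exists>M. matching (with_proj G) M \<and> covers_nonisolated M)"
proof -
  obtain ev u where basis: "hermitian_eigenbasis (pverts G) adj (length vs) ev u"
    and en: "gain_energy vs G \<phi> = (\<Sum>i<length vs. \<bar>ev i\<bar>)"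
    by (rule exists_adj_eigenbasis[OF vs])
  obtain M where M: "matching (with_proj G) M" "card M = matching_number (with_proj G)"
    by (rule exists_maximum_matching)
  obtain m where pm: "\<And>w. w \<in> \<Union>M \<Longrightarrow> m w \<in> \<Union>M" "\<And>w. w \<in> \<Union>M \<Longrightarrow> m (m w) = w"
      "\<And>w. w \<in> \<Union>M \<Longrightarrow> (w, m w) \<in> parcs G"
    using matching_partner[OF M(1)] by metis
  interpret matched_eigenbasis "pverts G" adj "length vs" ev u "\<Union>M" m
    by (rule matched_eigenbasisI[OF basis M(1) pm])
  have B: "abs_entry w v = (if w \<in> \<Union>M then adj w (m w) * adj (m w) v else 0)"
    if "w \<in> pverts G" "v \<in> pverts G" for w v
    using that by (intro abs_entry_eq) (simp_all add: card_Union_matching[OF M(1)] M(2) en[symmetric] eq)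
  have V: "w \<in> pverts G" if "w \<in> \<Union>M" for w using that S by blast
  have cov: "w \<in> \<Union>M" if wv: "(w, v) \<in> parcs G" for w v
  proof (rule ccontr)
    assume w: "w \<notin> \<Union>M"
    then have v: "v \<in> \<Union>M" using maximum_matching_covers[OF M wv] by blast
    have wV: "w \<in> pverts G" using wv in_arcsD1 by blast
    \<comment> \<open>The row of an uncovered \<open>w\<close> is 0, hence so is its column; but the
      entry in row \<open>m v\<close> is a product of the gains of the edges from \<open>m v\<close>
      to \<open>v\<close> and from \<open>v\<close> to \<open>w\<close>.\<close>
    have "abs_entry (m v) w = cnj (abs_entry w (m v))" by (rule abs_entry_cnj)
    also have "\<dots> = 0" using w wV V[OF pm(1)[OF v]] by (simp add: B)
    finally have "adj (m v) v * adj v w = 0"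
      using v pm wV V by (simp add: B)
    then show False
      using pm(3)[OF v] wv arcs_sym by (auto simp: adj_eq_0_iff)
  qed
  have diag: "abs_entry w w = 1" if "w \<in> \<Union>M" for w
    using that V pm by (simp add: B adj_mult_adj)
  have norm: "cmod (abs_entry w v) = 1" if "w \<in> \<Union>M" "(m w, v) \<in> parcs G" for w v
    using that V pm(3) in_arcsD2 by (simp add: B norm_mult cmod_adj)
  have "(w, v) \<in> parcs G \<and> \<phi> (w, v) = \<phi> (w, z) * \<phi> (z, y) * \<phi> (y, v)"
    if wz: "(w, z) \<in> parcs G" and zy: "(z, y) \<in> parcs G" and yv: "(y, v) \<in> parcs G" for w z y v
  proof -
    have S': "w \<in> \<Union>M" "z \<in> \<Union>M" "y \<in> \<Union>M" "v \<in> \<Union>M"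
      using cov wz zy yv arcs_sym by blast+
    note V' = V[OF S'(1)] V[OF S'(2)] V[OF S'(3)] V[OF S'(4)]
    have yz: "abs_entry (m y) z = adj (m y) y * adj y z"
      using S' V V' pm by (simp add: B)
    \<comment> \<open>Row \<open>m w\<close> is compared with row \<open>z\<close>, and row
      \<open>z\<close> with row \<open>m y\<close>, all at column \<open>v\<close>. The two factors
      have modulus 1 because of the edges \<open>w z\<close> and \<open>z y\<close>.\<close>
    have "cmod (abs_entry (m w) z) = 1" using S' pm wz by (intro norm) auto
    then have e1: "abs_entry (m w) v = abs_entry (m w) z * abs_entry z v"
      using S' pm by (intro abs_entry_mult diag) auto
    \<comment> \<open>Applied to the entry \<open>(z, m y)\<close>, \<open>B\<close> would lead
      through \<open>m z\<close>; applied to the conjugate entry \<open>(m y, z)\<close> it leads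
      through \<open>m (m y) = y\<close>.\<close>
    have "cmod (abs_entry z (m y)) = 1"
      unfolding abs_entry_cnj[of z] complex_mod_cnj using S' pm zy arcs_sym by (intro norm) auto
    then have e2: "abs_entry z v = abs_entry z (m y) * abs_entry (m y) v"
      using S' pm by (intro abs_entry_mult diag) auto
    have e3: "abs_entry z (m y) = adj z y * adj y (m y)"
      unfolding abs_entry_cnj[of z] yz by (simp add: adj_cnj[symmetric] mult.commute)
    have e4: "abs_entry (m y) v = adj (m y) y * adj y v" "abs_entry (m w) z = adj (m w) w * adj w z"
      "abs_entry (m w) v = adj (m w) w * adj w v"
      using S' V V' pm by (simp_all add: B)
    from e1 have "adj (m w) w * adj w v = adj (m w) w * (adj w z * adj z y * (adj y (m y) * adj (m y) y) * adj y v)"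
      unfolding e2 e3 e4 by (simp only: mult_ac)
    moreover have "adj (m w) w \<noteq> 0" using S' pm arcs_sym by (auto simp: adj_eq_0_iff)
    moreover have "adj y (m y) * adj (m y) y = 1" using S' pm by (simp add: adj_mult_adj)
    ultimately have *: "adj w v = adj w z * adj z y * adj y v" by simp
    moreover have "adj w z * adj z y * adj y v \<noteq> 0" using that by (simp add: adj_eq_0_iff)
    ultimately have "(w, v) \<in> parcs G" by (metis adj_eq_0_iff)
    then show ?thesis using * that by (simp add: adj_def)
  qed
  then show ?thesis using cov M unfolding three_walks_close_def covers_nonisolated_def by blast
qed

section \<open>Energy when three-step walks close\<close>

definition nbrs :: "'a \<Rightarrow> 'a set" where
  "nbrs w = {v. (w, v) \<in> parcs G}"

lemma nbrs_subset: "nbrs w \<subseteq> pverts G"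
  using in_arcsD2 by (auto simp: nbrs_def)

lemma finite_nbrs: "finite (nbrs w)"
  using nbrs_subset pair_finite_verts finite_subset by blast

lemma sum_nbrs: "(\<Sum>v\<in>pverts G. if (w, v) \<in> parcs G then 1 else 0) = of_nat (card (nbrs w))"
proof -
  have "pverts G \<inter> {v. (w, v) \<in> parcs G} = nbrs w" using nbrs_subset by (auto simp: nbrs_def)
  then show ?thesis using pair_finite_verts by (simp add: sum.If_cases)
qed

text \<open>The partner map sends neighbours of \<open>w\<close> injectively to neighbours of
  \<open>v\<close>: for a neighbour \<open>z\<close> of \<open>w\<close>, the walk
  \<open>m z, z, w, v\<close> closes. By symmetry the degrees agree.\<close>

lemma card_nbrs_eq:
  assumes W: three_walks_close and M: "matching (with_proj G) M" "covers_nonisolated M"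
    and wv: "(w, v) \<in> parcs G"
  shows "card (nbrs w) = card (nbrs v)"
proof -
  obtain m where m: "\<And>w. w \<in> \<Union>M \<Longrightarrow> m (m w) = w" "\<And>w. w \<in> \<Union>M \<Longrightarrow> (w, m w) \<in> parcs G"
    using matching_partner[OF M(1)] by metis
  have *: "card (nbrs w) \<le> card (nbrs v)" if wv: "(w, v) \<in> parcs G" for w v
  proof (rule card_inj_on_le[OF _ _ finite_nbrs])
    have N: "z \<in> \<Union>M" if "z \<in> nbrs w" for z
      using that M(2) arcs_sym unfolding covers_nonisolated_def nbrs_def by blast
    show "inj_on m (nbrs w)" using m(1) N by (metis inj_onI)
    show "m ` nbrs w \<subseteq> nbrs v"
    proof
      fix x assume "x \<in> m ` nbrs w"
      then obtain z where z: "z \<in> nbrs w" "x = m z" by blast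
      then have "(x, z) \<in> parcs G" "(z, w) \<in> parcs G"
        using m(2)[OF N] arcs_sym by (auto simp: nbrs_def)
      then show "x \<in> nbrs v"
        using W wv arcs_sym unfolding three_walks_close_def nbrs_def by blast
    qed
  qed
  show ?thesis using *[OF wv] *[OF arcs_sym[OF wv]] by simp
qed

text \<open>The left side is an entry of the cube of the adjacency matrix. Let \<open>z\<close> be a
  neighbour of \<open>w\<close> and \<open>y\<close> one of \<open>v\<close>. If \<open>z y\<close>
  is an edge, the walk closes and its gain is \<open>adj w v\<close>; if not, \<open>w v\<close> is
  no edge either, since otherwise \<open>z, w, v, y\<close> would close, and both values are
  0.\<close>

lemma sum_three_walks:
  assumes W: three_walks_close
  shows "(\<Sum>z\<in>pverts G. \<Sum>y\<in>pverts G. adj w z * adj z y * adj y v)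
    = of_nat (card (nbrs w)) * of_nat (card (nbrs v)) * adj w v"
proof -
  have "adj w z * adj z y * adj y v = 
    (if (w, z) \<in> parcs G then 1 else 0) * (if (v, y) \<in> parcs G then 1 else 0) * adj w v" for z y
  proof (cases "(w, z) \<in> parcs G \<and> (v, y) \<in> parcs G")
    case True
    then have yv: "(y, v) \<in> parcs G" and zw: "(z, w) \<in> parcs G" using arcs_sym by auto
    show ?thesis
    proof (cases "(z, y) \<in> parcs G")
      case zy: True
      then have "(w, v) \<in> parcs G \<and> \<phi> (w, v) = \<phi> (w, z) * \<phi> (z, y) * \<phi> (y, v)"
        using W True yv unfolding three_walks_close_def by blast
      then show ?thesis using True zy yv by (simp add: adj_def)
    next
      case False
      then have "(w, v) \<notin> parcs G" using W True zw unfolding three_walks_close_def by blast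
      then show ?thesis using False by (simp add: adj_def)
    qed
  next
    case False
    then show ?thesis using arcs_sym by (auto simp: adj_def)
  qed
  moreover have "(\<Sum>z\<in>A. \<Sum>y\<in>A. p z * q y * c) = (\<Sum>z\<in>A. p z) * (\<Sum>y\<in>A. q y) * c"
    for A :: "'a set" and p q :: "'a \<Rightarrow> complex" and c
    by (subst sum_product) (simp only: sum_distrib_right)
  ultimately show ?thesis by (simp only: sum_nbrs)
qed

theorem energy_eq_card_nonisolated:
  assumes vs: "distinct vs" "set vs = pverts G"
    and W: three_walks_close and M: "matching (with_proj G) M" "covers_nonisolated M"
  shows "gain_energy vs G \<phi> = real (card (\<Union>M))"
proof -
  obtain ev u where B: "hermitian_eigenbasis (pverts G) adj (length vs) ev u"
    and en: "gain_energy vs G \<phi> = (\<Sum>i<length vs. \<bar>ev i\<bar>)"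
    by (rule exists_adj_eigenbasis[OF vs])
  interpret hermitian_eigenbasis "pverts G" adj "length vs" ev u by fact
  let ?n = "length vs" and ?V = "pverts G" and ?d = "\<lambda>w. card (nbrs w)"
  \<comment> \<open>The cube of the adjacency matrix is applied to \<open>u i\<close> in two ways:
    through the eigenvalue and through \<open>sum_three_walks\<close>, where adjacent vertices have
    equal degree.\<close>
  have cube: "complex_of_real (ev i ^ 3) * u i w = complex_of_real ((real (?d w))\<^sup>2 * ev i) * u i w"
    if i: "i < ?n" and w: "w \<in> ?V" for i w
  proof -
    have eig: "ev i * u i z = (\<Sum>v\<in>?V. adj z v * u i v)" if "z \<in> ?V" for z
      using eigen[OF i that] by simp
    have "complex_of_real (ev i ^ 3) * u i w = complex_of_real ((ev i)\<^sup>2) * (\<Sum>z\<in>?V. adj w z * u i z)"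
      unfolding eigen[OF i w] by (simp add: power2_eq_square power3_eq_cube)
    also have "\<dots> = complex_of_real (ev i) * (\<Sum>z\<in>?V. adj w z * (ev i * u i z))"
      by (simp add: sum_distrib_left power2_eq_square mult_ac)
    also have "\<dots> = complex_of_real (ev i) * (\<Sum>z\<in>?V. adj w z * (\<Sum>y\<in>?V. adj z y * u i y))"
      by (simp only: eig cong: sum.cong)
    also have "\<dots> = (\<Sum>z\<in>?V. adj w z * (\<Sum>y\<in>?V. adj z y * (ev i * u i y)))"
      by (simp add: sum_distrib_left mult_ac)
    also have "\<dots> = (\<Sum>z\<in>?V. adj w z * (\<Sum>y\<in>?V. adj z y * (\<Sum>v\<in>?V. adj y v * u i v)))"
      by (simp only: eig cong: sum.cong)
    also have "\<dots> = (\<Sum>z\<in>?V. \<Sum>y\<in>?V. \<Sum>v\<in>?V. adj w z * adj z y * adj y v * u i v)"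
      by (simp add: sum_distrib_left mult.assoc)
    also have "\<dots> = (\<Sum>z\<in>?V. \<Sum>v\<in>?V. \<Sum>y\<in>?V. adj w z * adj z y * adj y v * u i v)"
      by (rule sum.cong[OF refl]) (rule sum.swap)
    also have "\<dots> = (\<Sum>v\<in>?V. \<Sum>z\<in>?V. \<Sum>y\<in>?V. adj w z * adj z y * adj y v * u i v)"
      by (rule sum.swap)
    also have "\<dots> = (\<Sum>v\<in>?V. (of_nat (?d w) * of_nat (?d v) * adj w v) * u i v)"
      by (simp only: sum_distrib_right[symmetric] sum_three_walks[OF W])
    also have "\<dots> = (\<Sum>v\<in>?V. (of_nat (?d w))\<^sup>2 * (adj w v * u i v))"
    proof (intro sum.cong refl)
      fix v
      show "(of_nat (?d w) * of_nat (?d v) * adj w v) * u i v = (of_nat (?d w))\<^sup>2 * (adj w v * u i v)"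
        using card_nbrs_eq[OF W M, of w v] by (cases "(w, v) \<in> parcs G") (auto simp: adj_def power2_eq_square)
    qed
    also have "\<dots> = (of_nat (?d w))\<^sup>2 * (ev i * u i w)"
      unfolding sum_distrib_left[symmetric] eigen[OF i w] ..
    finally show ?thesis by simp
  qed
  have abs_deg: "\<bar>ev i\<bar> * real (?d w) * (cmod (u i w))\<^sup>2 = (ev i)\<^sup>2 * (cmod (u i w))\<^sup>2"
    if i: "i < ?n" and w: "w \<in> ?V" for i w
  proof (cases "u i w = 0 \<or> ev i = 0")
    case False
    then have "ev i ^ 3 = (real (?d w))\<^sup>2 * ev i"
      using cube[OF i w] by (simp only: mult_cancel_right of_real_eq_iff) auto
    then have "\<bar>ev i\<bar>\<^sup>2 = (real (?d w))\<^sup>2" using False by (simp add: power3_eq_cube power2_eq_square)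
    then have "\<bar>ev i\<bar> = real (?d w)" by (rule power2_eq_imp_eq) auto
    then show ?thesis by (metis power2_abs power2_eq_square)
  qed auto
  \<comment> \<open>The diagonal of the squared matrix, computed spectrally and as the number of
    closed two-step walks.\<close>
  have sq: "(\<Sum>i<?n. (ev i)\<^sup>2 * (cmod (u i w))\<^sup>2) = real (?d w)" if w: "w \<in> ?V" for w
  proof -
    have "complex_of_real (\<Sum>i<?n. (ev i)\<^sup>2 * (cmod (u i w))\<^sup>2) = (\<Sum>i<?n. ev i * (ev i * u i w) * cnj (u i w))"
      by (simp only: of_real_sum of_real_mult complex_norm_square)
         (simp only: power2_eq_square of_real_mult mult_ac)
    also have "\<dots> = (\<Sum>i<?n. ev i * (\<Sum>v\<in>?V. adj w v * u i v) * cnj (u i w))"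
      using w by (intro sum.cong) (simp_all add: eigen)
    also have "\<dots> = (\<Sum>v\<in>?V. adj w v * (\<Sum>i<?n. ev i * u i v * cnj (u i w)))"
      by (simp add: sum_distrib_left sum_distrib_right sum.swap[of _ "{..<?n}"] mult_ac)
    also have "\<dots> = (\<Sum>v\<in>?V. adj w v * adj v w)"
      using w by (intro sum.cong) (simp_all add: expansion)
    also have "\<dots> = complex_of_real (real (?d w))"
      by (simp add: adj_mult_adj sum_nbrs)
    finally show ?thesis unfolding of_real_eq_iff .
  qed
  \<comment> \<open>This is the diagonal of the absolute value. Multiplied by the degree it becomes
    the diagonal of the square by \<open>abs_deg\<close>, so it is 1 if the degree is nonzero; at
    degree 0 the sum in \<open>sq\<close> vanishes term by term, and this sum with it.\<close>
  have one: "(\<Sum>i<?n. \<bar>ev i\<bar> * (cmod (u i w))\<^sup>2) = (if w \<in> \<Union>M then 1 else 0)" if w: "w \<in> ?V" for w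
  proof -
    have "real (?d w) * (\<Sum>i<?n. \<bar>ev i\<bar> * (cmod (u i w))\<^sup>2) = (\<Sum>i<?n. \<bar>ev i\<bar> * real (?d w) * (cmod (u i w))\<^sup>2)"
      by (simp add: sum_distrib_left mult_ac)
    also have "\<dots> = (\<Sum>i<?n. (ev i)\<^sup>2 * (cmod (u i w))\<^sup>2)"
      using w by (intro sum.cong) (simp_all add: abs_deg)
    finally have *: "real (?d w) * (\<Sum>i<?n. \<bar>ev i\<bar> * (cmod (u i w))\<^sup>2) = real (?d w)"
      using sq[OF w] by simp
    have iso: "?d w = 0 \<longleftrightarrow> w \<notin> \<Union>M"
    proof -
      have "w \<in> \<Union>M \<longleftrightarrow> nbrs w \<noteq> {}"
        using M matching_partner[OF M(1)] unfolding covers_nonisolated_def nbrs_def by (metis (mono_tags, lifting) empty_iff equals0I mem_Collect_eq)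
      then show ?thesis using finite_nbrs by auto
    qed
    show ?thesis
    proof (cases "?d w = 0")
      case True
      then have "(\<Sum>i<?n. (ev i)\<^sup>2 * (cmod (u i w))\<^sup>2) = 0" using sq[OF w] by simp
      then have "(ev i)\<^sup>2 * (cmod (u i w))\<^sup>2 = 0" if "i < ?n" for i
        using that by (subst (asm) sum_nonneg_eq_0_iff) auto
      then have "\<bar>ev i\<bar> * (cmod (u i w))\<^sup>2 = 0" if "i < ?n" for i
        using that by fastforce
      then have "(\<Sum>i<?n. \<bar>ev i\<bar> * (cmod (u i w))\<^sup>2) = 0" by (intro sum.neutral) auto
      then show ?thesis using iso True by simp
    next
      case False
      then show ?thesis using * iso by simp
    qed
  qed
  \<comment> \<open>The trace of the absolute value is evaluated over eigenvalues, then over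
    vertices.\<close>
  have "gain_energy vs G \<phi> = (\<Sum>i<?n. \<bar>ev i\<bar> * (\<Sum>w\<in>?V. (cmod (u i w))\<^sup>2))"
    by (simp add: en unit)
  also have "\<dots> = (\<Sum>w\<in>?V. \<Sum>i<?n. \<bar>ev i\<bar> * (cmod (u i w))\<^sup>2)"
    unfolding sum_distrib_left by (rule sum.swap)
  also have "\<dots> = (\<Sum>w\<in>?V. if w \<in> \<Union>M then 1 else 0)"
    using one by simp
  also have "\<dots> = real (card (?V \<inter> \<Union>M))"
    using finite_V by (simp add: sum.If_cases del: Union_iff)
  also have "?V \<inter> \<Union>M = \<Union>M" using Union_matching_subset[OF M(1)] by blast
  finally show ?thesis .
qed

theorem energy_eq_iff:
  assumes vs: "distinct vs" "set vs = pverts G"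
  shows "gain_energy vs G \<phi> = 2 * real (matching_number (with_proj G)) \<longleftrightarrow>
    three_walks_close \<and> (\<exists>M. matching (with_proj G) M \<and> covers_nonisolated M)"
proof
  assume "three_walks_close \<and> (\<exists>M. matching (with_proj G) M \<and> covers_nonisolated M)"
  then obtain M where *: three_walks_close "matching (with_proj G) M" "covers_nonisolated M" by blast
  have "gain_energy vs G \<phi> = 2 * real (card M)"
    using energy_eq_card_nonisolated[OF vs *] card_Union_matching[OF *(2)] by simp
  \<comment> \<open>A sandwich: the energy is \<open>2 * card M\<close>, which is at most twice the
    matching number, which is at most the energy.\<close>
  then show "gain_energy vs G \<phi> = 2 * real (matching_number (with_proj G))"
    using matching_number_le_energy[OF vs] card_le_matching_number[OF *(2)] by linarith
qed (use energy_eq_imp[OF vs] in blast)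

end


section \<open>Connected components\<close>

text \<open>With symmetric arcs, the vertices reachable from \<open>u\<close> induce a strongly
  connected subgraph, which contains every connected subgraph through \<open>u\<close>.\<close>

lemma (in sym_digraph) components_eq: "components G = (\<lambda>u. G \<restriction> {v. u \<rightarrow>\<^sup>* v}) ` verts G"
proof -
  have sub: "subgraph (G \<restriction> {v. u \<rightarrow>\<^sup>* v}) G" for u
    by (rule subgraph_induce_subgraphI) (auto elim: reachable_in_vertsE)
  have conn: "Digraph_Component.connected (G \<restriction> {v. u \<rightarrow>\<^sup>* v})" if u: "u \<in> verts G" for u
  proof -
    interpret K: wf_digraph "G \<restriction> {v. u \<rightarrow>\<^sup>* v}" by (rule wellformed_induce_subgraph)
    have "strongly_connected (G \<restriction> {v. u \<rightarrow>\<^sup>* v})"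
      using induce_reachable_is_in_sccs[OF u] by (rule in_sccsE)
    then show ?thesis
      by (intro K.connectedI K.reachable_mk_symmetricI) (auto simp: strongly_connected_def)
  qed
  have max: "subgraph H (G \<restriction> {v. u \<rightarrow>\<^sup>* v})"
    if H: "subgraph H G" "Digraph_Component.connected H" "u \<in> verts H" for H u
  proof -
    have "u \<rightarrow>\<^sup>* v" if v: "v \<in> verts H" for v
    proof -
      \<comment> \<open>Connectedness is defined through the symmetric closure, which passes
        monotonically from \<open>H\<close> to \<open>G\<close> and does not change reachability in
        \<open>G\<close>.\<close>
      have "u \<rightarrow>\<^sup>*\<^bsub>with_proj (mk_symmetric H)\<^esub> v"
        using H v by (auto simp: Digraph_Component.connected_def strongly_connected_def)
      then have "u \<rightarrow>\<^sup>*\<^bsub>with_proj (mk_symmetric G)\<^esub> v"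
        using subgraph_mk_symmetric[OF H(1)] by (rule pre_digraph.reachable_mono)
      then show ?thesis by (simp add: reachable_mk_symmetric_eq[OF sym_arcs])
    qed
    then have *: "verts H \<subseteq> {v. u \<rightarrow>\<^sup>* v}" by blast
    have wf: "wf_digraph H" and c: "compatible G H" using H(1) by (auto simp: subgraph_def)
    show ?thesis
    proof (rule subgraphI)
      have "e \<in> arcs G \<and> tail G e \<in> verts H \<and> head G e \<in> verts H" if "e \<in> arcs H" for e
        using that H(1) c wf_digraph.tail_in_verts[OF wf that] wf_digraph.head_in_verts[OF wf that]
        by (auto simp: subgraph_def compatible_def)
      then show "arcs H \<subseteq> arcs (G \<restriction> {v. u \<rightarrow>\<^sup>* v})" using * by auto
    qed (use * wf c in \<open>auto simp: compatible_def\<close>)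
  qed
  have eqI: "H = K" if "subgraph H K" "subgraph K H" for H K :: "('a, 'b) pre_digraph"
    using that by (intro pre_digraph.equality) (auto simp: subgraph_def compatible_def)
  show ?thesis
  proof (intro equalityI subsetI)
    fix H assume "H \<in> components G"
    then have H: "subgraph H G" "Digraph_Component.connected H"
      and m: "\<And>H'. H' \<noteq> H \<Longrightarrow> subgraph H H' \<Longrightarrow> subgraph H' G \<Longrightarrow> \<not> Digraph_Component.connected H'"
      by (auto simp: components_def max_subgraph_def)
    from H(2) obtain u where u: "u \<in> verts H"
      by (auto simp: Digraph_Component.connected_def strongly_connected_def)
    then have uG: "u \<in> verts G" using H(1) by (auto simp: subgraph_def)
    have "G \<restriction> {v. u \<rightarrow>\<^sup>* v} = H" using m max[OF H u] sub[of u] conn[OF uG] by blast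
    then show "H \<in> (\<lambda>u. G \<restriction> {v. u \<rightarrow>\<^sup>* v}) ` verts G" using uG by blast
  next
    fix H assume "H \<in> (\<lambda>u. G \<restriction> {v. u \<rightarrow>\<^sup>* v}) ` verts G"
    then obtain u where u: "u \<in> verts G" and H: "H = G \<restriction> {v. u \<rightarrow>\<^sup>* v}" by blast
    have "H' = H" if "subgraph H H'" "subgraph H' G" "Digraph_Component.connected H'" for H'
    proof (rule eqI)
      have "u \<in> verts H'" using that(1) u by (auto simp: H subgraph_def)
      then show "subgraph H' H" unfolding H using max that(2,3) by blast
    qed fact
    then show "H \<in> components G"
      using sub[of u] conn[OF u] unfolding components_def max_subgraph_def H by blast
  qed
qed

text \<open>If gains are quotients of a unimodular potential \<open>\<psi>\<close>, the product
  along a walk telescopes; closed walks then have gain 1.\<close>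

lemma walk_gain_potential:
  assumes "pcas x p y" "set p \<subseteq> A" "cmod (\<psi> x) = 1"
    and "\<And>a b. (a, b) \<in> A \<Longrightarrow> \<phi> (a, b) = \<psi> a * cnj (\<psi> b) \<and> cmod (\<psi> b) = 1"
  shows "walk_gain \<phi> p = \<psi> x * cnj (\<psi> y)"
  using assms(1-3)
proof (induction p arbitrary: x)
  case Nil
  then show ?case by (simp add: walk_gain_def complex_norm_square[symmetric])
next
  case (Cons e p)
  obtain b where e: "e = (x, b)" "pcas b p y" "(x, b) \<in> A" using Cons.prems by (cases e) auto
  have b: "\<phi> (x, b) = \<psi> x * cnj (\<psi> b)" "cmod (\<psi> b) = 1" using assms(4)[OF e(3)] by auto
  have "walk_gain \<phi> (e # p) = \<phi> (x, b) * (\<psi> b * cnj (\<psi> y))"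
    using Cons.IH[OF e(2) _ b(2)] Cons.prems(2) by (simp add: walk_gain_def e)
  also have "\<dots> = \<psi> x * (\<psi> b * cnj (\<psi> b)) * cnj (\<psi> y)" by (simp add: b(1) mult_ac)
  also have "\<psi> b * cnj (\<psi> b) = 1" using b(2) by (simp add: complex_norm_square[symmetric])
  finally show ?case by simp
qed

section \<open>From closing walks to balanced complete bipartite components\<close>

context gain_graph
begin

definition component_verts :: "'a \<Rightarrow> 'a set" where
  "component_verts u = {v. u \<rightarrow>\<^sup>*\<^bsub>with_proj G\<^esub> v}"

definition component_of :: "'a \<Rightarrow> ('a, 'a \<times> 'a) pre_digraph" where
  "component_of u = with_proj G \<restriction> component_verts u"

lemma components_component_of: "components (with_proj G) = component_of ` pverts G"
  using components_eq unfolding component_of_def component_verts_def .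

lemma component_of_simps [simp]:
  "verts (component_of u) = component_verts u" "arcs (component_of u) = {e \<in> parcs G. fst e \<in> component_verts u \<and> snd e \<in> component_verts u}"
  "tail (component_of u) = fst" "head (component_of u) = snd"
  by (auto simp: component_of_def)

lemma arcs_ends_component_of: "arcs_ends (component_of u) = parcs G \<inter> component_verts u \<times> component_verts u"
  by (auto simp: arcs_ends_conv)

lemma component_verts_self: "u \<in> pverts G \<Longrightarrow> u \<in> component_verts u"
  by (simp add: component_verts_def)

lemma component_verts_arc: "v \<in> component_verts u \<Longrightarrow> (v, w) \<in> parcs G \<Longrightarrow> w \<in> component_verts u"
  unfolding component_verts_def using reachable_adj_trans[of u v w] by auto

lemma component_verts_subset: "component_verts u \<subseteq> pverts G"
  using reachable_in_verts by (auto simp: component_verts_def)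

lemma component_of_eq:
  assumes "x \<in> component_verts u" "x \<in> component_verts v"
  shows "component_of u = component_of v"
proof -
  have sym: "b \<rightarrow>\<^sup>*\<^bsub>with_proj G\<^esub> a" if "a \<rightarrow>\<^sup>*\<^bsub>with_proj G\<^esub> b" for a b
    using symmetric_reachable[OF _ that] sym_arcs by simp
  have "u \<rightarrow>\<^sup>*\<^bsub>with_proj G\<^esub> v" "v \<rightarrow>\<^sup>*\<^bsub>with_proj G\<^esub> u"
    using reachable_trans[OF _ sym, of u x v] reachable_trans[OF _ sym, of v x u] assms
    unfolding component_verts_def mem_Collect_eq by blast+
  then have "component_verts u = component_verts v"
    using reachable_trans[of u v] reachable_trans[of v u] unfolding component_verts_def by blast
  then show ?thesis by (simp add: component_of_def)
qed

lemma graph_component_of: "graph (component_of u)"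
proof -
  have ind: "induced_subgraph (component_of u) (with_proj G)"
    unfolding component_of_def using component_verts_subset by (intro induced_induce) simp
  show ?thesis
    using induced_graph_imp_symmetric[OF sym_arcs ind]
    by (rule digraph.graphI[OF digraphI_induced[OF ind]])
qed

lemma cas_component_of: "pre_digraph.cas (component_of u) = pcas"
  using compatible_cas[of "component_of u" "with_proj G"] cas_with_proj_eq[of G] by (simp add: compatible_def)

definition good_component :: "('a, 'a \<times> 'a) pre_digraph \<Rightarrow> bool" where
  "good_component H \<longleftrightarrow> card (verts H) = 1 \<or>
    (balanced H \<phi> \<and> (\<exists>m n. complete_bipartite_digraph m n H) \<and> (\<exists>M. perfect_matching H M))"

lemma adj_arc: "(w, v) \<in> parcs G \<Longrightarrow> \<phi> (w, v) = cnj (\<phi> (v, w))"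
  using adj_cnj[of w v] arcs_sym by (simp add: adj_def)

lemma good_component_if_three_walks_close:
  assumes W: three_walks_close and M: "matching (with_proj G) M" "covers_nonisolated M"
    and u: "u \<in> pverts G"
  shows "good_component (component_of u)"
proof (cases "nbrs u = {}")
  case True
  have "v = u" if "v \<in> component_verts u" for v
    using that True unfolding component_verts_def nbrs_def
    by (auto elim: converse_reachable_cases)
  then have "component_verts u = {u}" using component_verts_self[OF u] by blast
  then show ?thesis by (simp add: good_component_def)
next
  case False
  then obtain u' where uu': "(u, u') \<in> parcs G" by (auto simp: nbrs_def)
  note u'u = arcs_sym[OF uu']
  have close: "(w, v) \<in> parcs G" "\<phi> (w, v) = \<phi> (w, z) * \<phi> (z, y) * \<phi> (y, v)"
    if "(w, z) \<in> parcs G" "(z, y) \<in> parcs G" "(y, v) \<in> parcs G" for w z y v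
    using W that unfolding three_walks_close_def by blast+
  \<comment> \<open>For the edge from \<open>u\<close> to \<open>u'\<close>, the two sides are the
    neighbourhoods of its ends: \<open>U\<close> contains \<open>u\<close> and \<open>X\<close>
    contains \<open>u'\<close>. A vertex in both would carry a loop by \<open>UXarc\<close>.\<close>
  define U where "U = nbrs u'"
  define X where "X = nbrs u"
  have UX: "y \<in> X" if "x \<in> U" "(x, y) \<in> parcs G" for x y
    using close(1)[OF uu' _ that(2)] that(1) by (simp add: U_def X_def nbrs_def)
  have XU: "y \<in> U" if "x \<in> X" "(x, y) \<in> parcs G" for x y
    using close(1)[OF u'u _ that(2)] that(1) by (simp add: U_def X_def nbrs_def)
  have UXarc: "(x, y) \<in> parcs G" if "x \<in> U" "y \<in> X" for x y
    using close(1)[OF _ u'u, of x y] that arcs_sym by (simp add: U_def X_def nbrs_def)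
  have disj: "U \<inter> X = {}"
    using UXarc arc_irrefl by blast
  have "v \<in> U \<union> X" if "u \<rightarrow>\<^sup>*\<^bsub>with_proj G\<^esub> v" for v
    using that
  proof (induction rule: reachable_induct)
    case base
    then show ?case using u'u by (simp add: U_def nbrs_def)
  next
    case (step x y)
    then show ?case using UX XU by auto
  qed
  moreover have "x \<in> component_verts u" if "x \<in> U \<union> X" for x
    using that component_verts_arc[OF component_verts_self[OF u]] component_verts_arc uu'
    unfolding U_def X_def nbrs_def by blast
  ultimately have C: "component_verts u = U \<union> X" unfolding component_verts_def by blast
  have arcs: "arcs_ends (component_of u) = U \<times> X \<union> X \<times> U"
    unfolding arcs_ends_component_of C using UX XU UXarc arcs_sym by blast
  have bip: "complete_bipartite_digraph (card U) (card X) (component_of u)"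
    unfolding complete_bipartite_digraph_def using graph_component_of arcs C disj by auto
  \<comment> \<open>The partner of a vertex stays in its component, so the edges of \<open>M\<close>
    inside the component cover it.\<close>
  have perfect: "perfect_matching (component_of u) {e \<in> M. e \<subseteq> component_verts u}"
    unfolding perfect_matching_def matching_def
  proof (intro conjI)
    show "{e \<in> M. e \<subseteq> component_verts u} \<subseteq> edges (component_of u)"
    proof
      fix e assume e: "e \<in> {e \<in> M. e \<subseteq> component_verts u}"
      then have "e \<in> edges (with_proj G)" using M(1) by (auto simp: matching_def)
      then obtain a b where "e = {a, b}" "(a, b) \<in> parcs G" unfolding edges_conv by blast
      then show "e \<in> edges (component_of u)" using e unfolding edges_def arcs_ends_component_of by blast
    qed
    show "pairwise disjnt {e \<in> M. e \<subseteq> component_verts u}"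
      by (rule pairwise_subset[of disjnt M]) (use M(1) in \<open>auto simp: matching_def\<close>)
    obtain m where m: "\<And>w. w \<in> \<Union>M \<Longrightarrow> {w, m w} \<in> M" "\<And>w. w \<in> \<Union>M \<Longrightarrow> (w, m w) \<in> parcs G"
      using matching_partner[OF M(1)] by metis
    have "x \<in> \<Union>{e \<in> M. e \<subseteq> component_verts u}" if x: "x \<in> component_verts u" for x
    proof -
      have "x \<in> \<Union>M"
        using x M(2) arcs_sym unfolding C U_def X_def nbrs_def covers_nonisolated_def by blast
      then show ?thesis using m[of x] component_verts_arc[OF x] x by blast
    qed
    then show "\<Union>{e \<in> M. e \<subseteq> component_verts u} = verts (component_of u)" by auto
  qed
  \<comment> \<open>\<open>\<psi> x\<close> is the gain of a walk from \<open>x\<close> to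
    \<open>u'\<close>: directly if \<open>x\<close> lies in \<open>U\<close>, and through
    \<open>u\<close> if it lies in \<open>X\<close>. Closure of the walks \<open>a, u', u, b\<close>
    and \<open>a, u, u', b\<close> makes it a potential for the gains.\<close>
  define \<psi> where "\<psi> x = (if x \<in> U then \<phi> (x, u') else \<phi> (x, u) * \<phi> (u, u'))" for x
  have \<psi>_norm: "cmod (\<psi> x) = 1" if "x \<in> component_verts u" for x
    using that arcs_sym uu' unfolding C by (auto simp: \<psi>_def U_def X_def nbrs_def norm_mult gain_unit)
  have \<psi>: "\<phi> (a, b) = \<psi> a * cnj (\<psi> b)" if "(a, b) \<in> arcs (component_of u)" for a b
  proof -
    have ab: "(a, b) \<in> parcs G" "a \<in> U \<and> b \<in> X \<or> a \<in> X \<and> b \<in> U"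
      using that UX XU unfolding component_of_simps C by auto
    from ab(2) show ?thesis
    proof
      assume *: "a \<in> U \<and> b \<in> X"
      then have "b \<notin> U" using disj by blast
      have "(a, u') \<in> parcs G" "(u, b) \<in> parcs G" using * arcs_sym by (auto simp: U_def X_def nbrs_def)
      then have "\<phi> (a, b) = \<phi> (a, u') * \<phi> (u', u) * \<phi> (u, b)" "\<phi> (u, b) = cnj (\<phi> (b, u))"
        using close(2) u'u adj_arc by auto
      then show ?thesis using * \<open>b \<notin> U\<close> adj_arc[OF u'u] by (simp add: \<psi>_def)
    next
      assume *: "a \<in> X \<and> b \<in> U"
      then have "a \<notin> U" using disj by blast
      have "(a, u) \<in> parcs G" "(u', b) \<in> parcs G" using * arcs_sym by (auto simp: U_def X_def nbrs_def)
      then have "\<phi> (a, b) = \<phi> (a, u) * \<phi> (u, u') * \<phi> (u', b)" "\<phi> (u', b) = cnj (\<phi> (b, u'))"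
        using close(2) uu' adj_arc by auto
      then show ?thesis using * \<open>a \<notin> U\<close> by (simp add: \<psi>_def)
    qed
  qed
  have "walk_gain \<phi> p = 1" if p: "pre_digraph.cycle (component_of u) p" for p
  proof -
    obtain x where x: "x \<in> component_verts u" "set p \<subseteq> arcs (component_of u)" "pcas x p x"
      using p unfolding pre_digraph.cycle_def pre_digraph.awalk_def cas_component_of by auto
    have "walk_gain \<phi> p = \<psi> x * cnj (\<psi> x)"
    proof (rule walk_gain_potential[where \<psi> = \<psi>, OF x(3,2) \<psi>_norm[OF x(1)]])
      fix a b assume "(a, b) \<in> arcs (component_of u)"
      then show "\<phi> (a, b) = \<psi> a * cnj (\<psi> b) \<and> cmod (\<psi> b) = 1" using \<psi> \<psi>_norm by auto
    qed
    then show ?thesis using \<psi>_norm[OF x(1)] by (simp add: complex_norm_square[symmetric])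
  qed
  then show ?thesis using bip perfect unfolding good_component_def balanced_def by blast
qed

section \<open>From the components back to closing walks and a covering matching\<close>

lemma card_component_verts_ne_1:
  assumes wv: "(w, v) \<in> parcs G"
  shows "card (component_verts w) \<noteq> 1"
proof
  assume "card (component_verts w) = 1"
  then obtain x where "component_verts w = {x}" by (rule card_1_singletonE)
  moreover have "w \<in> component_verts w" "v \<in> component_verts w"
    using component_verts_self[OF in_arcsD1[OF wv]] component_verts_arc[OF _ wv] by auto
  ultimately show False using no_loops'[OF wv] by simp
qed

text \<open>In a bipartite graph a walk of length three ends on the side opposite to its start, so
  completeness supplies the edge \<open>w v\<close>. Either the walk backtracks and two gains
  cancel, or it closes to a 4-cycle of gain 1.\<close>

lemma three_walks_close_if_good_components:
  assumes good: "\<And>u. u \<in> pverts G \<Longrightarrow> good_component (component_of u)"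
  shows three_walks_close
  unfolding three_walks_close_def
proof (intro allI impI)
  fix w z y v assume wz: "(w, z) \<in> parcs G" and zy: "(z, y) \<in> parcs G" and yv: "(y, v) \<in> parcs G"
  have w: "w \<in> pverts G" using wz in_arcsD1 by blast
  have C: "w \<in> component_verts w" "z \<in> component_verts w" "y \<in> component_verts w" "v \<in> component_verts w"
    using component_verts_self[OF w] component_verts_arc wz zy yv by blast+
  obtain U V where UV: "component_verts w = U \<union> V" "U \<inter> V = {}"
      "parcs G \<inter> component_verts w \<times> component_verts w = U \<times> V \<union> V \<times> U"
    and bal: "balanced (component_of w) \<phi>"
    using good[OF w] card_component_verts_ne_1[OF wz]
    unfolding good_component_def complete_bipartite_digraph_def arcs_ends_component_of component_of_simps by blast
  have "(w, z) \<in> U \<times> V \<union> V \<times> U" "(z, y) \<in> U \<times> V \<union> V \<times> U" "(y, v) \<in> U \<times> V \<union> V \<times> U"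
    using C wz zy yv unfolding UV(3)[symmetric] by auto
  then have "(w, v) \<in> U \<times> V \<union> V \<times> U" using UV(2) by blast
  then have wv: "(w, v) \<in> parcs G" unfolding UV(3)[symmetric] by blast
  have inv: "\<phi> (a, b) * \<phi> (b, a) = 1" if "(a, b) \<in> parcs G" for a b
    using adj_mult_adj[of a b] that arcs_sym[OF that] by (simp add: adj_def)
  have "\<phi> (w, v) = \<phi> (w, z) * \<phi> (z, y) * \<phi> (y, v)"
  proof (cases "w = y \<or> z = v")
    case True
    then show ?thesis using inv[OF wz] inv[OF zy] by (auto simp: mult.assoc)
  next
    case False
    let ?p = "[(w, z), (z, y), (y, v), (v, w)]"
    have "pre_digraph.cycle (component_of w) ?p"
      using False C wz zy yv arcs_sym[OF wv] no_loops'[OF wz] no_loops'[OF zy] no_loops'[OF yv] no_loops'[OF wv]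
      by (auto simp: pre_digraph.cycle_def pre_digraph.awalk_def cas_component_of pre_digraph.awalk_verts.simps)
    then have "walk_gain \<phi> ?p = 1" using bal by (simp add: balanced_def)
    then have "\<phi> (w, z) * \<phi> (z, y) * \<phi> (y, v) * \<phi> (v, w) = 1" by (simp add: walk_gain_def mult.assoc)
    then have "\<phi> (w, z) * \<phi> (z, y) * \<phi> (y, v) * (\<phi> (v, w) * \<phi> (w, v)) = \<phi> (w, v)"
      by (metis mult.assoc mult.left_neutral)
    then show ?thesis using inv[OF arcs_sym[OF wv]] by simp
  qed
  with wv show "(w, v) \<in> parcs G \<and> \<phi> (w, v) = \<phi> (w, z) * \<phi> (z, y) * \<phi> (y, v)" by blast
qed

lemma covering_matching_if_good_components:
  assumes good: "\<And>u. u \<in> pverts G \<Longrightarrow> good_component (component_of u)"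
  shows "\<exists>M. matching (with_proj G) M \<and> covers_nonisolated M"
proof -
  \<comment> \<open>The choice depends on the component and not on a base vertex, so that vertices
    of one component select the same perfect matching; the union over all components is then a
    matching.\<close>
  define f where "f H = (SOME M. perfect_matching H M)" for H :: "('a, 'a \<times> 'a) pre_digraph"
  have f: "perfect_matching (component_of u) (f (component_of u))" if "u \<in> pverts G" "card (component_verts u) \<noteq> 1" for u
  proof -
    have "\<exists>M. perfect_matching (component_of u) M"
      using good[OF that(1)] that(2) by (simp add: good_component_def)
    then show ?thesis unfolding f_def by (rule someI_ex)
  qed
  define M where "M = (\<Union>u\<in>{u \<in> pverts G. card (component_verts u) \<noteq> 1}. f (component_of u))"
  have sub: "e \<subseteq> component_verts u" "e \<in> edges (with_proj G)" "e \<noteq> {}"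
    if "u \<in> pverts G" "card (component_verts u) \<noteq> 1" "e \<in> f (component_of u)" for e u
  proof -
    have "e \<in> edges (component_of u)" using f[OF that(1,2)] that(3) by (auto simp: perfect_matching_def matching_def)
    then show "e \<subseteq> component_verts u" "e \<in> edges (with_proj G)" "e \<noteq> {}"
      by (auto simp: edges_def arcs_ends_component_of)
  qed
  have "disjnt e e'" if ee': "e \<in> M" "e' \<in> M" "e \<noteq> e'" for e e'
  proof -
    obtain u u' where u: "u \<in> pverts G" "card (component_verts u) \<noteq> 1" "e \<in> f (component_of u)"
        "u' \<in> pverts G" "card (component_verts u') \<noteq> 1" "e' \<in> f (component_of u')"
      using ee'(1,2) unfolding M_def by blast
    show ?thesis
    proof (cases "component_of u = component_of u'")
      case True
      then show ?thesis
        using f[OF u(1,2)] u(3,6) ee'(3) unfolding perfect_matching_def matching_def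
        by (metis pairwiseD)
    next
      case False
      then have "component_verts u \<inter> component_verts u' = {}" using component_of_eq[of _ u u'] by blast
      then show ?thesis using sub(1)[OF u(1-3)] sub(1)[OF u(4-6)] unfolding disjnt_def by blast
    qed
  qed
  then have "matching (with_proj G) M"
    using sub(2) by (auto simp: matching_def M_def pairwise_def)
  moreover have "covers_nonisolated M"
    unfolding covers_nonisolated_def
  proof (intro allI impI)
    fix w v assume wv: "(w, v) \<in> parcs G"
    then have w: "w \<in> pverts G" "card (component_verts w) \<noteq> 1" using in_arcsD1 card_component_verts_ne_1 by blast+
    then have "w \<in> \<Union>(f (component_of w))"
      using f[OF w] component_verts_self[OF w(1)] by (simp add: perfect_matching_def)
    then show "w \<in> \<Union>M" using w unfolding M_def by blast
  qed
  ultimately show ?thesis by blast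
qed

end

theorem theorem4p19:
  fixes G :: "'a pair_pre_digraph"
    and \<phi> :: "'a \<times> 'a \<Rightarrow> complex"
    and vs :: "'a list"
  assumes "gain_graph G \<phi>"
    and "distinct vs" and "set vs = pverts G"
  shows "gain_energy vs G \<phi> = 2 * real (matching_number (with_proj G)) \<longleftrightarrow>
    (\<forall>H\<in>components (with_proj G).
       card (verts H) = 1 \<or>
       (balanced H \<phi> \<and>
        (\<exists>m n. complete_bipartite_digraph m n H) \<and> (\<exists>M. perfect_matching H M)))"
proof -
  interpret gain_graph G \<phi> by fact
  show ?thesis
    unfolding energy_eq_iff[OF assms(2,3)] components_component_of good_component_def[symmetric] ball_simps
    using good_component_if_three_walks_close three_walks_close_if_good_components
      covering_matching_if_good_components by blast
qed

end
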